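(* Let $F$ be a finite group, and define groups recursively by $G_1=\mathbb{Z}^2\wr F$ and $G_{i+1}=\mathbb{Z}^2\wr G_i$. Then for some random walk on $G_i$ the entropy $H_{G_i}(n)$ satisfies, for all sufficiently large $n$, $$K_1\,\frac{n}{\bigl(\underbrace{\ln(\ln(\dots\ln}_{i}(n)\dots))\bigr)^2}\;\le\; H_{G_i}(n)\;\le\; K_2\,\frac{n}{\underbrace{\ln(\ln(\dots\ln}_{i}(n)\dots))}$$ for some positive constants $K_1$ and $K_2$. In particular, all $G_i$ have different asymptotics of the entropy.
   Context: The index $i$ is a positive integer. The wreath product $C\wr D$ is the semidirect product of $C$ and $\sum_C D$ (the group of finitely supported functions $f:C\to D$ with pointwise multiplication), where $C$ acts by shifts: $f^c(x)=f(xc^{-1})$ for $c,x\in C$. Random walks on a finitely generated group $G$ start at the identity and are driven by a symmetric probability measure $\mu$ on $G$ whose support is finite and generates $G$; the position at time $n$ has distribution $\mu^{*n}$ (the $n$-th convolution power). The entropy is $H(n)=H_G(n)=-\sum_{g\in G}\mu^{*n}(g)\ln(\mu^{*n}(g))$ (with $0\ln 0=0$).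
   Formalization: The finite group F is assumed to be nontrivial: for trivial F one has G_1 = Z^2, whose entropy grows only like ln n, so the stated lower bound fails. *)

theory Defs
  imports
    "HOL-Algebra.Algebra"
    "HOL-Probability.Probability_Mass_Function"
    "HOL-Library.Landau_Symbols"
begin

section \<open>Wreath products\<close>

text \<open>
  The pair \<open>(c, f)\<close> stands for the product \<open>c \<cdot> f\<close>, and the exponent for conjugation
  \<open>f\<^sup>c = c\<^sup>-\<^sup>1 f c\<close>, which is a right action: \<open>(f\<^sup>c)\<^sup>d = f\<^sup>c\<^sup>d\<close>.  Hence
  \<open>(c, f) (d, g) = (c d, f\<^sup>d g)\<close>.  Following \<^const>\<open>sum_group\<close>, functions on \<open>C\<close> are taken to be
  \<^const>\<open>undefined\<close> outside the carrier.
\<close>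

definition shift :: "('c, 'm) monoid_scheme \<Rightarrow> ('c \<Rightarrow> 'd) \<Rightarrow> 'c \<Rightarrow> 'c \<Rightarrow> 'd" where
  "shift C f c = (\<lambda>x\<in>carrier C. f (x \<otimes>\<^bsub>C\<^esub> inv\<^bsub>C\<^esub> c))"

definition wreath :: "('c, 'm) monoid_scheme \<Rightarrow> ('d, 'k) monoid_scheme \<Rightarrow> ('c \<times> ('c \<Rightarrow> 'd)) monoid" where
  "wreath C D =
    (let S = sum_group (carrier C) (\<lambda>_. D) in
      \<lparr> carrier = carrier C \<times> carrier S,
        monoid.mult = (\<lambda>(c, f) (d, g). (c \<otimes>\<^bsub>C\<^esub> d, shift C f d \<otimes>\<^bsub>S\<^esub> g)),
        one = (\<one>\<^bsub>C\<^esub>, \<one>\<^bsub>S\<^esub>) \<rparr>)"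

abbreviation Z2 :: "(int \<times> int) monoid" where
  "Z2 \<equiv> integer_group \<times>\<times> integer_group"

text \<open>
  Forming \<open>\<int>\<^sup>2 \<wr> _\<close> changes the type of the elements, so the recursion is carried out
  inside one type which contains a copy of \<open>'f\<close> and is closed under forming pairs \<open>(c, f)\<close>.
  Each step transports the group structure along the injective constructor; see
  \<open>iter_wreath_1_iso\<close> and \<open>iter_wreath_Suc_iso\<close> below.
\<close>

datatype 'f witer = Base 'f | Node "int \<times> int" "int \<times> int \<Rightarrow> 'f witer"

primrec iter_wreath :: "('f, 'm) monoid_scheme \<Rightarrow> nat \<Rightarrow> 'f witer monoid" where
  "iter_wreath F 0 = image_group Base F"
| "iter_wreath F (Suc i) = image_group (\<lambda>(c, f). Node c f) (wreath Z2 (iter_wreath F i))"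

section \<open>Random walks and entropy\<close>

definition random_walk_measure :: "('a, 'm) monoid_scheme \<Rightarrow> 'a pmf \<Rightarrow> bool" where
  "random_walk_measure G \<mu> \<longleftrightarrow>
    set_pmf \<mu> \<subseteq> carrier G \<and> finite (set_pmf \<mu>) \<and>
    (\<forall>g\<in>carrier G. pmf \<mu> (inv\<^bsub>G\<^esub> g) = pmf \<mu> g) \<and>
    generate G (set_pmf \<mu>) = carrier G"

primrec conv_power :: "('a, 'm) monoid_scheme \<Rightarrow> 'a pmf \<Rightarrow> nat \<Rightarrow> 'a pmf" where
  "conv_power G \<mu> 0 = return_pmf \<one>\<^bsub>G\<^esub>"
| "conv_power G \<mu> (Suc n) = map_pmf (\<lambda>(x, y). x \<otimes>\<^bsub>G\<^esub> y) (pair_pmf (conv_power G \<mu> n) \<mu>)"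

definition walk_entropy :: "('a, 'm) monoid_scheme \<Rightarrow> 'a pmf \<Rightarrow> nat \<Rightarrow> real" where
  "walk_entropy G \<mu> n =
    - (\<Sum>\<^sub>\<infinity>g\<in>carrier G. pmf (conv_power G \<mu> n) g * ln (pmf (conv_power G \<mu> n) g))"

section \<open>Basic facts\<close>

lemma shift_sum_group:
  assumes "group C" "group D" "c \<in> carrier C" "f \<in> carrier (sum_group (carrier C) (\<lambda>_. D))"
  shows "shift C f c \<in> carrier (sum_group (carrier C) (\<lambda>_. D))"
proof -
  interpret C: group C by fact
  have f: "f \<in> carrier C \<rightarrow>\<^sub>E carrier D" "finite {x \<in> carrier C. f x \<noteq> \<one>\<^bsub>D\<^esub>}"
    using assms by (auto simp: carrier_sum_group)
  have "{x \<in> carrier C. shift C f c x \<noteq> \<one>\<^bsub>D\<^esub>} \<subseteq>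
        (\<lambda>y. y \<otimes>\<^bsub>C\<^esub> c) ` {x \<in> carrier C. f x \<noteq> \<one>\<^bsub>D\<^esub>}"
  proof
    fix x assume x: "x \<in> {x \<in> carrier C. shift C f c x \<noteq> \<one>\<^bsub>D\<^esub>}"
    then have "x = (x \<otimes>\<^bsub>C\<^esub> inv\<^bsub>C\<^esub> c) \<otimes>\<^bsub>C\<^esub> c"
      using assms(3) by (simp add: C.m_assoc)
    then show "x \<in> (\<lambda>y. y \<otimes>\<^bsub>C\<^esub> c) ` {x \<in> carrier C. f x \<noteq> \<one>\<^bsub>D\<^esub>}"
      using x assms(3) by (auto simp: shift_def)
  qed
  then have "finite {x \<in> carrier C. shift C f c x \<noteq> \<one>\<^bsub>D\<^esub>}"
    using f(2) finite_surj by blast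
  moreover have "shift C f c \<in> carrier C \<rightarrow>\<^sub>E carrier D"
    using f(1) assms(3) by (auto simp: shift_def PiE_iff)
  ultimately show ?thesis
    using assms(2) by (simp add: carrier_sum_group)
qed

lemma group_wreath:
  assumes "group C" "group D"
  shows "group (wreath C D)"
proof -
  interpret C: group C by fact
  interpret D: group D by fact
  define S where "S = sum_group (carrier C) (\<lambda>_. D)"
  interpret S: group S unfolding S_def using assms by simp
  have sh: "shift C f c \<in> carrier S" if "f \<in> carrier S" "c \<in> carrier C" for f c
    using shift_sum_group[OF assms] that by (simp add: S_def)
  have W: "carrier (wreath C D) = carrier C \<times> carrier S"
    "\<And>c f d g. (c, f) \<otimes>\<^bsub>wreath C D\<^esub> (d, g) = (c \<otimes>\<^bsub>C\<^esub> d, shift C f d \<otimes>\<^bsub>S\<^esub> g)"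
    "\<one>\<^bsub>wreath C D\<^esub> = (\<one>\<^bsub>C\<^esub>, \<one>\<^bsub>S\<^esub>)"
    by (simp_all add: wreath_def S_def Let_def)
  have shift_mult: "shift C (f \<otimes>\<^bsub>S\<^esub> g) c = shift C f c \<otimes>\<^bsub>S\<^esub> shift C g c"
    if "c \<in> carrier C" for f g c
    using that by (auto simp: S_def shift_def intro!: restrict_ext)
  have shift_shift: "shift C (shift C f c) d = shift C f (c \<otimes>\<^bsub>C\<^esub> d)"
    if "c \<in> carrier C" "d \<in> carrier C" for f c d
    using that by (auto simp: shift_def C.inv_mult_group C.m_assoc intro!: restrict_ext)
  have shift_one: "shift C \<one>\<^bsub>S\<^esub> c = \<one>\<^bsub>S\<^esub>" if "c \<in> carrier C" for c
    using that by (auto simp: S_def shift_def intro!: restrict_ext)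
  have shift_id: "shift C f \<one>\<^bsub>C\<^esub> = f" if "f \<in> carrier S" for f
    using that assms
    by (auto simp: S_def shift_def carrier_sum_group PiE_iff extensional_def restrict_def)
  show ?thesis
  proof (rule groupI)
    fix x y z assume "x \<in> carrier (wreath C D)" "y \<in> carrier (wreath C D)" "z \<in> carrier (wreath C D)"
    then show "x \<otimes>\<^bsub>wreath C D\<^esub> y \<otimes>\<^bsub>wreath C D\<^esub> z = x \<otimes>\<^bsub>wreath C D\<^esub> (y \<otimes>\<^bsub>wreath C D\<^esub> z)"
      by (auto simp: W(1) W(2) shift_mult shift_shift C.m_assoc S.m_assoc sh)
  next
    fix x assume "x \<in> carrier (wreath C D)"
    then obtain c f where x: "x = (c, f)" "c \<in> carrier C" "f \<in> carrier S"
      by (auto simp: W(1))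
    let ?y = "(inv\<^bsub>C\<^esub> c, shift C (inv\<^bsub>S\<^esub> f) (inv\<^bsub>C\<^esub> c))"
    have "?y \<in> carrier (wreath C D)" "?y \<otimes>\<^bsub>wreath C D\<^esub> x = \<one>\<^bsub>wreath C D\<^esub>"
      using x by (auto simp: W sh shift_shift shift_id)
    then show "\<exists>y\<in>carrier (wreath C D). y \<otimes>\<^bsub>wreath C D\<^esub> x = \<one>\<^bsub>wreath C D\<^esub>"
      by blast
  qed (auto simp: W sh shift_one)
qed

lemma group_Z2: "group Z2"
  by (simp add: DirProd_group)

lemma group_iter_wreath:
  assumes "group F"
  shows "group (iter_wreath F i)"
proof (induction i)
  case 0
  show ?case
    using group.inj_imp_image_group_is_group[OF assms, of Base] by (simp add: inj_on_def)
next
  case (Suc i)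
  show ?case
    using group.inj_imp_image_group_is_group[OF group_wreath[OF group_Z2 Suc], of "\<lambda>(c, f). Node c f"]
    by (simp add: inj_on_def split_def prod_eq_iff)
qed

lemma iter_wreath_0_iso: "F \<cong> iter_wreath F 0"
  using inj_imp_image_group_iso[of Base F] by (auto simp: inj_on_def is_iso_def)

lemma iter_wreath_Suc_iso: "wreath Z2 (iter_wreath F i) \<cong> iter_wreath F (Suc i)"
proof -
  have "inj_on (\<lambda>(c, f). Node c f) (carrier (wreath Z2 (iter_wreath F i)))"
    by (auto simp: inj_on_def)
  from inj_imp_image_group_iso[OF this] show ?thesis
    by (auto simp: is_iso_def)
qed

lemma wreath_cong:
  fixes C :: "('a, 'm) monoid_scheme"
  assumes "group C" "group D" "group E" "D \<cong> E"
  shows "wreath C D \<cong> wreath C E"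
proof -
  interpret C: group C by fact
  obtain h where h: "h \<in> iso D E"
    using assms(4) by (auto simp: is_iso_def)
  define k where "k = inv_into (carrier D) h"
  have bij: "bij_betw h (carrier D) (carrier E)"
    using h by (simp add: iso_def)
  have k: "k \<in> iso E D" "\<And>x. x \<in> carrier D \<Longrightarrow> k (h x) = x"
      "\<And>y. y \<in> carrier E \<Longrightarrow> h (k y) = y"
    using group.iso_set_sym[OF assms(2) h] bij_betw_inv_into_left[OF bij]
      bij_betw_inv_into_right[OF bij] by (simp_all add: k_def)
  have maps: "(\<lambda>x\<in>carrier C. p (f x)) \<in> carrier (sum_group (carrier C) (\<lambda>_. B))"
    if "group A" "group B" "p \<in> hom A B" "f \<in> carrier (sum_group (carrier C) (\<lambda>_. A))"
    for A :: "('x, 'u) monoid_scheme" and B :: "('y, 'v) monoid_scheme" and p f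
  proof -
    have f: "f \<in> carrier C \<rightarrow>\<^sub>E carrier A" "finite {x \<in> carrier C. f x \<noteq> \<one>\<^bsub>A\<^esub>}"
      using that by (auto simp: carrier_sum_group)
    have "{x \<in> carrier C. p (f x) \<noteq> \<one>\<^bsub>B\<^esub>} \<subseteq> {x \<in> carrier C. f x \<noteq> \<one>\<^bsub>A\<^esub>}"
      using hom_one[OF that(3,1,2)] by auto
    then have "finite {x \<in> carrier C. p (f x) \<noteq> \<one>\<^bsub>B\<^esub>}"
      using f(2) finite_subset by blast
    moreover have "(\<lambda>x\<in>carrier C. p (f x)) \<in> carrier C \<rightarrow>\<^sub>E carrier B"
      using f(1) hom_carrier[OF that(3)] by auto
    ultimately show ?thesis
      using that(2) by (simp add: carrier_sum_group conj_commute cong: conj_cong)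
  qed
  define H where "H = (\<lambda>(c :: 'a, f). (c, \<lambda>x\<in>carrier C. h (f x)))"
  define K where "K = (\<lambda>(c :: 'a, f). (c, \<lambda>x\<in>carrier C. k (f x)))"
  have hom: "h \<in> hom D E" "k \<in> hom E D"
    using h k(1) by (auto simp: iso_def)
  have fD: "f \<in> carrier C \<rightarrow>\<^sub>E carrier D" if "f \<in> carrier (sum_group (carrier C) (\<lambda>_. D))" for f
    using that assms by (simp add: carrier_sum_group)
  have fE: "f \<in> carrier C \<rightarrow>\<^sub>E carrier E" if "f \<in> carrier (sum_group (carrier C) (\<lambda>_. E))" for f
    using that assms by (simp add: carrier_sum_group)
  have carr: "carrier (wreath C D) = carrier C \<times> carrier (sum_group (carrier C) (\<lambda>_. D))"
      "carrier (wreath C E) = carrier C \<times> carrier (sum_group (carrier C) (\<lambda>_. E))"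
    by (simp_all add: wreath_def Let_def)
  have HK: "H a \<in> carrier (wreath C E)" "K (H a) = a" if a: "a \<in> carrier (wreath C D)" for a
  proof -
    obtain c f where cf: "a = (c, f)" "c \<in> carrier C" "f \<in> carrier (sum_group (carrier C) (\<lambda>_. D))"
      using a unfolding carr by blast
    show "H a \<in> carrier (wreath C E)"
      using maps[OF assms(2,3) hom(1) cf(3)] cf(2) unfolding carr cf(1) H_def by simp
    have "(\<lambda>x\<in>carrier C. k ((\<lambda>x\<in>carrier C. h (f x)) x)) = (\<lambda>x\<in>carrier C. f x)"
      by (rule restrict_ext) (simp add: k(2) PiE_mem[OF fD[OF cf(3)]])
    also have "\<dots> = f"
      using fD[OF cf(3)] by (rule PiE_restrict)
    finally show "K (H a) = a"
      by (simp only: cf(1) H_def K_def case_prod_conv)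
  qed
  have KH: "K a \<in> carrier (wreath C D)" "H (K a) = a" if a: "a \<in> carrier (wreath C E)" for a
  proof -
    obtain c f where cf: "a = (c, f)" "c \<in> carrier C" "f \<in> carrier (sum_group (carrier C) (\<lambda>_. E))"
      using a unfolding carr by blast
    show "K a \<in> carrier (wreath C D)"
      using maps[OF assms(3,2) hom(2) cf(3)] cf(2) unfolding carr cf(1) K_def by simp
    have "(\<lambda>x\<in>carrier C. h ((\<lambda>x\<in>carrier C. k (f x)) x)) = (\<lambda>x\<in>carrier C. f x)"
      by (rule restrict_ext) (simp add: k(3) PiE_mem[OF fE[OF cf(3)]])
    also have "\<dots> = f"
      using fE[OF cf(3)] by (rule PiE_restrict)
    finally show "H (K a) = a"
      by (simp only: cf(1) H_def K_def case_prod_conv)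
  qed
  have "bij_betw H (carrier (wreath C D)) (carrier (wreath C E))"
    by (rule bij_betw_byWitness[where f' = K]) (use HK KH in blast)+
  moreover have "H \<in> hom (wreath C D) (wreath C E)"
  proof (rule homI)
    fix a b assume ab: "a \<in> carrier (wreath C D)" "b \<in> carrier (wreath C D)"
    obtain c f where cf: "a = (c, f)" "c \<in> carrier C" "f \<in> carrier (sum_group (carrier C) (\<lambda>_. D))"
      using ab(1) unfolding carr by blast
    obtain d g where dg: "b = (d, g)" "d \<in> carrier C" "g \<in> carrier (sum_group (carrier C) (\<lambda>_. D))"
      using ab(2) unfolding carr by blast
    have fg: "f x \<in> carrier D" "g x \<in> carrier D" if "x \<in> carrier C" for x
      using that PiE_mem[OF fD[OF cf(3)]] PiE_mem[OF fD[OF dg(3)]] by blast+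
    have "(\<lambda>x\<in>carrier C. h (f (x \<otimes>\<^bsub>C\<^esub> inv\<^bsub>C\<^esub> d) \<otimes>\<^bsub>D\<^esub> g x)) =
          (\<lambda>x\<in>carrier C. h (f (x \<otimes>\<^bsub>C\<^esub> inv\<^bsub>C\<^esub> d)) \<otimes>\<^bsub>E\<^esub> h (g x))"
      by (rule restrict_ext) (simp add: hom_mult[OF hom(1)] fg dg(2))
    then show "H (a \<otimes>\<^bsub>wreath C D\<^esub> b) = H a \<otimes>\<^bsub>wreath C E\<^esub> H b"
      using dg(2) by (simp add: cf(1) dg(1) wreath_def Let_def H_def shift_def cong: restrict_cong)
  qed (rule HK)
  ultimately show ?thesis
    by (auto simp: is_iso_def iso_def)
qed

lemma iter_wreath_1_iso:
  assumes "group F"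
  shows "wreath Z2 F \<cong> iter_wreath F 1"
proof -
  have "wreath Z2 F \<cong> wreath Z2 (iter_wreath F 0)"
    using wreath_cong[OF group_Z2 assms group_iter_wreath[OF assms] iter_wreath_0_iso] .
  also have "\<dots> \<cong> iter_wreath F (Suc 0)"
    by (rule iter_wreath_Suc_iso)
  finally show ?thesis by simp
qed

end

theory Submission
  imports Defs "HOL-Probability.Product_PMF" "HOL-Analysis.Harmonic_Numbers" "HOL-Real_Asymp.Real_Asymp"
begin

text \<open>
  For the walks constructed here the entropy of \<open>G\<^sub>i\<close> is of the exact order \<open>n / ln\<^sub>i n\<close>, where \<open>ln\<^sub>i\<close> is the
  \<open>i\<close>-fold logarithm, which gives both bounds. The reason is a recursion.

  Let \<open>\<nu>\<close> drive a walk on \<open>D\<close>. On the wreath product of \<open>\<int>\<^sup>2\<close> with \<open>D\<close> the lamplighter switches the lamp at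
  its position by \<open>\<nu>\<close>, makes a step of a planar random walk, and switches again. Given the planar trajectory the lamps
  are independent, and the lamp at \<open>x\<close> is at time \<open>L(x)\<close> of the walk on \<open>D\<close>, where \<open>L(x)\<close> is the number of
  switches at \<open>x\<close> (\<open>conv_power_mu\<close>). So the entropy should be the expectation of the sum of \<open>H\<^sub>D(L(x))\<close> over all
  sites. A planar walk of length \<open>n\<close> sees about \<open>n / ln n\<close> sites, each about \<open>ln n\<close> times, and
  \<open>H\<^sub>D(n) = n / f(n)\<close> becomes \<open>n / f(ln n)\<close>. The recursion starts with the uniform distribution on \<open>F\<close>, whose
  entropy is a positive constant, that is, with \<open>f(n) = n\<close>.

  For the lower bound, conditioning on the trajectory decreases entropy. The numbers \<open>L(x)\<close> add up to \<open>2 n\<close>, and the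
  expected sum of their squares is \<open>O(n ln n)\<close> because the probability of return at time \<open>k\<close> is \<open>O(1 / k)\<close>
  (\<open>expected_sum_visits_squared_le\<close>). Hence half of the switches take place at sites with \<open>L(x) = O(ln n)\<close>
  (\<open>entropy_mu_lower\<close>).

  For the upper bound, entropy is at most cross-entropy relative to any other distribution. Along the recursion one
  distribution \<open>q\<close> on \<open>D\<close> is kept relative to which the walk has small cross-entropy at all times. The
  corresponding distribution on the wreath product draws a tour, an end point on it and lamps from \<open>q\<close> along it.
  Since the range of a walk is covered by a tour of at most twice its size (\<open>covering_tour\<close>), the cost of an
  element is linear in the range plus the cost of its lamps, and the expected range is \<open>O(n / ln n)\<close>
  (\<open>expected_range_le\<close>, \<open>cross_entropy_reference\<close>).

  For \<open>i < j\<close> the entropy of \<open>G\<^sub>j\<close> is not \<open>O\<close> of that of \<open>G\<^sub>i\<close>: with \<open>y = ln\<^sub>i n\<close> this would bound \<open>y\<close> by a multiple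
  of the square of \<open>ln\<^sub>j n\<close>, hence of the square of \<open>ln y\<close>.
\<close>

section \<open>Iterated logarithms\<close>

text \<open>
  The function \<open>1 + ln x\<close> replaces the logarithm. It maps \<open>[1, \<infinity>)\<close> to itself, so its
  iterates are defined and at least \<open>1\<close> for every \<open>n \<ge> 1\<close>, and the induction on the number of wreath
  products needs no exceptional small \<open>n\<close>. Asymptotically the iterates agree with those of \<open>ln\<close> up to a constant factor.
\<close>

definition slog :: "real \<Rightarrow> real" where
  "slog x = 1 + ln x"

abbreviation iter_slog :: "nat \<Rightarrow> real \<Rightarrow> real" where
  "iter_slog i \<equiv> slog ^^ i"

lemma iter_slog_Suc: "iter_slog (Suc i) x = iter_slog i (slog x)"
  by (simp only: funpow_Suc_right o_apply)

lemma slog_ge_1: "1 \<le> x \<Longrightarrow> 1 \<le> slog x"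
  by (simp add: slog_def)

lemma slog_le: "1 \<le> x \<Longrightarrow> slog x \<le> x"
  using ln_le_minus_one[of x] by (simp add: slog_def)

lemma slog_mono: "1 \<le> x \<Longrightarrow> x \<le> y \<Longrightarrow> slog x \<le> slog y"
  by (simp add: slog_def)

lemma slog_mult_le:
  assumes "1 \<le> k" "1 \<le> x"
  shows "slog (k * x) \<le> k * slog x"
proof -
  have "slog (k * x) = slog k + ln x"
    using assms by (simp add: slog_def ln_mult)
  also have "\<dots> \<le> k + k * ln x"
    using slog_le[OF assms(1)] mult_right_mono[OF assms(1), of "ln x"] assms(2) by simp
  finally show ?thesis
    by (simp add: slog_def algebra_simps)
qed

lemma iter_slog_ge_1: "1 \<le> x \<Longrightarrow> 1 \<le> iter_slog i x"
  by (induction i) (simp_all add: slog_ge_1)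

lemma iter_slog_le: "1 \<le> x \<Longrightarrow> iter_slog i x \<le> x"
proof (induction i)
  case (Suc i)
  then show ?case
    using slog_le[OF iter_slog_ge_1[OF Suc.prems, of i]] by simp
qed simp

lemma iter_slog_mono: "1 \<le> x \<Longrightarrow> x \<le> y \<Longrightarrow> iter_slog i x \<le> iter_slog i y"
  by (induction i) (simp_all add: slog_mono iter_slog_ge_1)

text \<open>
  Sublinearity is what lets multiplicative constants inside an iterated logarithm be pulled out,
  and it makes \<open>x / iter_slog i x\<close> nondecreasing.
\<close>

lemma iter_slog_mult_le:
  assumes "1 \<le> k" "1 \<le> x"
  shows "iter_slog i (k * x) \<le> k * iter_slog i x"
  using assms(2)
proof (induction i arbitrary: x)
  case (Suc i)
  have "1 * 1 \<le> k * x"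
    using assms(1) Suc.prems by (intro mult_mono) auto
  then have "iter_slog i (slog (k * x)) \<le> iter_slog i (k * slog x)"
    using assms(1) Suc.prems by (intro iter_slog_mono slog_mult_le slog_ge_1) auto
  also have "\<dots> \<le> k * iter_slog i (slog x)"
    using Suc.prems by (intro Suc.IH slog_ge_1)
  finally show ?case
    by (simp only: iter_slog_Suc)
qed simp

lemma div_iter_slog_mono:
  assumes "1 \<le> x" "x \<le> y"
  shows "x / iter_slog i x \<le> y / iter_slog i y"
proof -
  have "iter_slog i y \<le> y / x * iter_slog i x"
    using iter_slog_mult_le[of "y / x" x i] assms by simp
  then show ?thesis
    using assms iter_slog_ge_1[of x i] iter_slog_ge_1[of y i]
    by (simp add: divide_simps mult_ac)
qed

lemma filterlim_iter_ln: "filterlim (ln ^^ i :: real \<Rightarrow> real) at_top at_top"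
proof (induction i)
  case 0
  then show ?case by (simp add: id_def filterlim_ident)
next
  case (Suc i)
  show ?case
    using filterlim_compose[OF ln_at_top Suc] by simp
qed

lemma iter_ln_le_iter_slog: "\<forall>\<^sub>F x in at_top. (ln ^^ i) x \<le> iter_slog i x"
proof (induction i)
  case (Suc i)
  have "\<forall>\<^sub>F x in at_top. 0 < (ln ^^ i) (x :: real)"
    using filterlim_iter_ln[of i] by (simp add: filterlim_at_top_dense)
  with Suc show ?case
  proof eventually_elim
    case (elim x)
    then have "ln ((ln ^^ i) x) \<le> ln (iter_slog i x)"
      by (intro ln_mono) auto
    then show ?case by (simp add: slog_def[of "iter_slog i x"])
  qed
qed simp

lemma iter_slog_le_iter_ln: "\<exists>C\<ge>1. \<forall>\<^sub>F x in at_top. iter_slog i x \<le> C * (ln ^^ i) x"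
proof (induction i)
  case (Suc i)
  then obtain C where C: "C \<ge> 1" "\<forall>\<^sub>F x in at_top. iter_slog i x \<le> C * (ln ^^ i) x"
    by blast
  have "\<forall>\<^sub>F x in at_top. 0 < (ln ^^ i) (x :: real)" "\<forall>\<^sub>F x in at_top. 1 + ln C \<le> (ln ^^ Suc i) (x :: real)"
    using filterlim_iter_ln[of i] filterlim_iter_ln[of "Suc i"]
    unfolding filterlim_at_top_dense[of "ln ^^ i"] filterlim_at_top[of "ln ^^ Suc i"] by blast+
  with C(2) eventually_ge_at_top[of 1] have "\<forall>\<^sub>F x in at_top. iter_slog (Suc i) x \<le> 2 * (ln ^^ Suc i) x"
  proof eventually_elim
    case (elim x)
    have "ln (iter_slog i x) \<le> ln (C * (ln ^^ i) x)"
      using elim(1) iter_slog_ge_1[OF elim(2), of i] by (intro ln_mono) auto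
    also have "\<dots> = ln C + ln ((ln ^^ i) x)"
      using elim C(1) by (simp add: ln_mult)
    finally show ?case
      using elim by (simp add: slog_def[of "iter_slog i x"])
  qed
  then show ?case
    by (intro exI[of _ 2]) simp
qed (auto intro!: exI[of _ 1])

section \<open>Cross-entropy\<close>

text \<open>
  For \<open>q = p\<close> this is the Shannon entropy of \<open>p\<close>; in general it is the expected length of a code for
  samples of \<open>p\<close> that is optimal for \<open>q\<close>.
\<close>

definition cross_entropy :: "'a pmf \<Rightarrow> 'a pmf \<Rightarrow> real" where
  "cross_entropy p q = measure_pmf.expectation p (\<lambda>x. - ln (pmf q x))"

lemma expectation_mono_finite:
  fixes f g :: "'a \<Rightarrow> real"
  assumes "finite (set_pmf p)" "\<And>x. x \<in> set_pmf p \<Longrightarrow> f x \<le> g x"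
  shows "measure_pmf.expectation p f \<le> measure_pmf.expectation p g"
  using assms by (intro integral_mono_AE integrable_measure_pmf_finite) (auto simp: AE_measure_pmf_iff)

lemma expectation_cong:
  fixes f g :: "'a \<Rightarrow> real"
  assumes "\<And>x. x \<in> set_pmf p \<Longrightarrow> f x = g x"
  shows "measure_pmf.expectation p f = measure_pmf.expectation p g"
  using assms by (intro integral_cong_AE) (auto simp: AE_measure_pmf_iff)

lemma expectation_bind_finite:
  fixes h :: "'b \<Rightarrow> real"
  assumes "finite (set_pmf p)" "\<And>x. x \<in> set_pmf p \<Longrightarrow> finite (set_pmf (k x))"
  shows "measure_pmf.expectation (bind_pmf p k) h =
    measure_pmf.expectation p (\<lambda>x. measure_pmf.expectation (k x) h)"
  using assms by (subst pmf_expectation_bind[of "set_pmf p"])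
    (auto simp: integral_measure_pmf[of "set_pmf p" p])

text \<open>
  Gibbs' inequality: no code beats the one made for \<open>p\<close>. All upper bounds for entropies below are
  obtained by exhibiting a suitable \<open>q\<close>.
\<close>

lemma entropy_le_cross_entropy:
  assumes fin: "finite (set_pmf p)" and sub: "set_pmf p \<subseteq> set_pmf q"
  shows "cross_entropy p p \<le> cross_entropy p q"
proof -
  let ?A = "set_pmf p"
  have "cross_entropy p p - cross_entropy p q = (\<Sum>a\<in>?A. pmf p a * (ln (pmf q a) - ln (pmf p a)))"
    using fin by (simp add: cross_entropy_def integral_measure_pmf[of ?A] sum_subtractf[symmetric] algebra_simps)
  also have "\<dots> \<le> (\<Sum>a\<in>?A. pmf q a - pmf p a)"
  proof (rule sum_mono)
    fix a assume a: "a \<in> ?A"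
    then have pos: "pmf p a > 0" "pmf q a > 0"
      using sub by (auto simp: pmf_positive)
    then have "ln (pmf q a) - ln (pmf p a) \<le> pmf q a / pmf p a - 1"
      using ln_le_minus_one[of "pmf q a / pmf p a"] by (simp add: ln_div)
    then have "pmf p a * (ln (pmf q a) - ln (pmf p a)) \<le> pmf p a * (pmf q a / pmf p a - 1)"
      by (rule mult_left_mono) simp
    then show "pmf p a * (ln (pmf q a) - ln (pmf p a)) \<le> pmf q a - pmf p a"
      using pos by (simp add: algebra_simps)
  qed
  also have "\<dots> = measure q ?A - 1"
    using fin by (simp add: sum_subtractf measure_measure_pmf_finite sum_pmf_eq_1)
  also have "\<dots> \<le> 0"
    by simp
  finally show ?thesis by simp
qed

text \<open>
  Conditioning decreases entropy: by Gibbs' inequality each conditional distribution has entropy at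
  most its cross-entropy relative to the mixture, and these cross-entropies average to the entropy of the mixture.
\<close>

lemma entropy_bind_ge:
  assumes "finite (set_pmf p)" "\<And>x. x \<in> set_pmf p \<Longrightarrow> finite (set_pmf (k x))"
  shows "measure_pmf.expectation p (\<lambda>x. cross_entropy (k x) (k x)) \<le>
    cross_entropy (bind_pmf p k) (bind_pmf p k)"
proof -
  have "measure_pmf.expectation p (\<lambda>x. cross_entropy (k x) (k x)) \<le>
      measure_pmf.expectation p (\<lambda>x. cross_entropy (k x) (bind_pmf p k))"
    using assms by (intro expectation_mono_finite entropy_le_cross_entropy) auto
  also have "\<dots> = cross_entropy (bind_pmf p k) (bind_pmf p k)"
    using assms unfolding cross_entropy_def by (simp only: expectation_bind_finite)
  finally show ?thesis .
qed

lemma cross_entropy_map_inj: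
  "inj f \<Longrightarrow> cross_entropy (map_pmf f p) (map_pmf f q) = cross_entropy p q"
  by (simp add: cross_entropy_def pmf_map_inj')

lemma finite_set_Pi_pmf:
  "finite A \<Longrightarrow> (\<And>x. x \<in> A \<Longrightarrow> finite (set_pmf (p x))) \<Longrightarrow> finite (set_pmf (Pi_pmf A d p))"
  by (auto simp: set_Pi_pmf)

lemma expectation_Pi_pmf_component:
  fixes h :: "'b \<Rightarrow> real"
  assumes "finite A" "x \<in> A"
  shows "measure_pmf.expectation (Pi_pmf A d p) (\<lambda>f. h (f x)) = measure_pmf.expectation (p x) h"
  using assms integral_map_pmf[of "\<lambda>f. f x" "Pi_pmf A d p" h] by (simp add: Pi_pmf_component)

lemma expectation_Pi_pmf_sum:
  fixes h :: "'a \<Rightarrow> 'b \<Rightarrow> real"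
  assumes "finite A" "\<And>x. x \<in> A \<Longrightarrow> finite (set_pmf (p x))" "B \<subseteq> A"
  shows "measure_pmf.expectation (Pi_pmf A d p) (\<lambda>f. \<Sum>x\<in>B. h x (f x)) =
    (\<Sum>x\<in>B. measure_pmf.expectation (p x) (h x))"
proof -
  have "measure_pmf.expectation (Pi_pmf A d p) (\<lambda>f. \<Sum>x\<in>B. h x (f x)) =
      (\<Sum>x\<in>B. measure_pmf.expectation (Pi_pmf A d p) (\<lambda>f. h x (f x)))"
    using assms by (intro Bochner_Integration.integral_sum integrable_measure_pmf_finite finite_set_Pi_pmf) auto
  also have "\<dots> = (\<Sum>x\<in>B. measure_pmf.expectation (p x) (h x))"
    using assms by (intro sum.cong expectation_Pi_pmf_component) auto
  finally show ?thesis .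
qed

lemma entropy_Pi_pmf:
  assumes "finite A" "\<And>x. x \<in> A \<Longrightarrow> finite (set_pmf (p x))"
  shows "cross_entropy (Pi_pmf A d p) (Pi_pmf A d p) = (\<Sum>x\<in>A. cross_entropy (p x) (p x))"
proof -
  have "cross_entropy (Pi_pmf A d p) (Pi_pmf A d p) =
      measure_pmf.expectation (Pi_pmf A d p) (\<lambda>f. \<Sum>x\<in>A. - ln (pmf (p x) (f x)))"
    unfolding cross_entropy_def
  proof (rule expectation_cong)
    fix f assume "f \<in> set_pmf (Pi_pmf A d p)"
    then have f: "\<And>x. x \<notin> A \<Longrightarrow> f x = d" "\<And>x. x \<in> A \<Longrightarrow> pmf (p x) (f x) > 0"
      using assms(1) by (auto simp: set_Pi_pmf PiE_dflt_def pmf_positive)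
    then have "\<And>x. x \<in> A \<Longrightarrow> pmf (p x) (f x) \<noteq> 0"
      by force
    with f(1) show "- ln (pmf (Pi_pmf A d p) f) = (\<Sum>x\<in>A. - ln (pmf (p x) (f x)))"
      using assms(1) by (simp add: pmf_Pi' ln_prod sum_negf)
  qed
  also have "\<dots> = (\<Sum>x\<in>A. cross_entropy (p x) (p x))"
    using assms by (simp add: expectation_Pi_pmf_sum[where h = "\<lambda>x y. - ln (pmf (p x) y)"] cross_entropy_def)
  finally show ?thesis .
qed

lemma pmf_bind_ge: "pmf p x * pmf (k x) y \<le> pmf (bind_pmf p k) y"
proof -
  have "pmf p x * pmf (k x) y = measure_pmf.expectation p (\<lambda>z. indicator {x} z * pmf (k x) y)"
    by (simp add: measure_pmf_single)
  also have "\<dots> \<le> measure_pmf.expectation p (\<lambda>z. pmf (k z) y)"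
    by (intro integral_mono measure_pmf.integrable_const_bound[where B = 1])
      (auto simp: pmf_le_1 mult_le_one split: split_indicator)
  finally show ?thesis
    by (simp add: pmf_bind)
qed

lemma walk_entropy_eq_cross_entropy:
  assumes "finite (set_pmf (conv_power G \<mu> n))" "set_pmf (conv_power G \<mu> n) \<subseteq> carrier G"
  shows "walk_entropy G \<mu> n = cross_entropy (conv_power G \<mu> n) (conv_power G \<mu> n)"
proof -
  let ?p = "conv_power G \<mu> n"
  have "(\<Sum>\<^sub>\<infinity>g\<in>carrier G. pmf ?p g * ln (pmf ?p g)) = (\<Sum>\<^sub>\<infinity>g\<in>set_pmf ?p. pmf ?p g * ln (pmf ?p g))"
    using assms by (intro infsum_cong_neutral) (auto simp: set_pmf_iff)
  then show ?thesis
    using assms by (simp add: walk_entropy_def cross_entropy_def integral_measure_pmf[of "set_pmf ?p"])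
qed

section \<open>The lazy random walk on the plane\<close>

text \<open>
  A step is the sum of two half-steps \<open>\<plusminus> 1/2\<close> decided by fair coins, so after \<open>n\<close> steps a coordinate is a
  centred binomial variable with \<open>2 n\<close> trials. Two independent copies give a planar walk whose return probabilities are
  known exactly.
\<close>

definition lazy_step :: "int pmf" where
  "lazy_step = map_pmf (\<lambda>k. int k - 1) (binomial_pmf 2 (1 / 2))"

definition planar_step :: "(int \<times> int) pmf" where
  "planar_step = pair_pmf lazy_step lazy_step"

text \<open>
  The list of steps of a walk is kept with the latest step first, because elements of the wreath
  product will be multiplied from the left.
\<close>

abbreviation traj :: "nat \<Rightarrow> (int \<times> int) list pmf" where
  "traj n \<equiv> replicate_pmf n planar_step"

lemma set_lazy_step: "set_pmf lazy_step = {-1, 0, 1}"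
  by (auto simp: lazy_step_def image_iff atMost_Suc numeral_2_eq_2)

lemma set_planar_step: "set_pmf planar_step = {-1, 0, 1} \<times> {-1, 0, 1}"
  by (simp add: planar_step_def set_lazy_step)

lemma uminus_planar_step: "s \<in> set_pmf planar_step \<Longrightarrow> - s \<in> set_pmf planar_step"
  by (cases s) (auto simp: set_planar_step)

lemma pmf_lazy_step:
  "pmf lazy_step x = (if x = 0 then 1 / 2 else if \<bar>x\<bar> = 1 then 1 / 4 else 0)"
proof -
  have inj: "inj (\<lambda>k. int k - 1)" by (simp add: inj_on_def)
  have "pmf lazy_step (int k - 1) = pmf (binomial_pmf 2 (1 / 2)) k" for k
    unfolding lazy_step_def using pmf_map_inj'[OF inj] .
  from this[of 0] this[of 1] this[of 2]
  have "pmf lazy_step (-1) = 1 / 4" "pmf lazy_step 0 = 1 / 2" "pmf lazy_step 1 = 1 / 4"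
    by (simp_all add: power2_eq_square)
  moreover have "pmf lazy_step x = 0" if "x \<notin> {-1, 0, 1}"
    using that by (simp add: set_lazy_step[symmetric] set_pmf_iff)
  ultimately show ?thesis by (auto simp: abs_if)
qed

lemma pmf_planar_step_ge: "s \<in> set_pmf planar_step \<Longrightarrow> 1 / 16 \<le> pmf planar_step s"
  unfolding set_planar_step by (auto simp: planar_step_def pmf_pair pmf_lazy_step)

lemma map_uminus_planar_step: "map_pmf uminus planar_step = planar_step"
proof -
  have "map_pmf uminus lazy_step = lazy_step"
  proof (rule pmf_eqI)
    fix x :: int
    have "pmf (map_pmf uminus lazy_step) (- (- x)) = pmf lazy_step (- x)"
      by (rule pmf_map_inj') simp
    then show "pmf (map_pmf uminus lazy_step) x = pmf lazy_step x"
      by (simp add: pmf_lazy_step)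
  qed
  moreover have "map_pmf uminus planar_step = map_pmf (\<lambda>(x, y). (- x, - y)) (pair_pmf lazy_step lazy_step)"
    unfolding planar_step_def by (rule map_pmf_cong) auto
  ultimately show ?thesis
    by (simp only: planar_step_def map_pair)
qed

lemma finite_traj: "finite (set_pmf (traj n))"
  unfolding set_replicate_pmf
  using finite_lists_length_eq[of "set_pmf planar_step" n] by (simp add: set_planar_step lists_eq_set)

lemma length_traj: "ss \<in> set_pmf (traj n) \<Longrightarrow> length ss = n"
  by (simp add: set_replicate_pmf)

text \<open>
  The Markov property: the last \<open>k\<close> steps are independent of the earlier ones.
\<close>

lemma traj_split:
  assumes "k \<le> n"
  shows "map_pmf (\<lambda>ss. (take k ss, drop k ss)) (traj n) = pair_pmf (traj k) (traj (n - k))"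
proof -
  have "traj n = do {us \<leftarrow> traj k; vs \<leftarrow> traj (n - k); return_pmf (us @ vs)}"
    using replicate_pmf_distrib[of k "n - k" planar_step] assms by simp
  then show ?thesis
    by (auto simp: map_bind_pmf pair_pmf_def length_traj intro!: bind_pmf_cong)
qed

lemma expectation_traj_take_drop:
  fixes f g :: "(int \<times> int) list \<Rightarrow> real"
  assumes "k \<le> n"
  shows "measure_pmf.expectation (traj n) (\<lambda>ss. f (take k ss) * g (drop k ss)) =
    measure_pmf.expectation (traj k) f * measure_pmf.expectation (traj (n - k)) g"
proof -
  have "measure_pmf.expectation (traj n) (\<lambda>ss. f (take k ss) * g (drop k ss)) =
      measure_pmf.expectation (map_pmf (\<lambda>ss. (take k ss, drop k ss)) (traj n)) (\<lambda>(us, vs). f us * g vs)"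
    by simp
  also have "\<dots> = measure_pmf.expectation (traj k) f * measure_pmf.expectation (traj (n - k)) g"
    unfolding traj_split[OF assms] pair_pmf_def
    by (simp add: expectation_bind_finite finite_traj)
  finally show ?thesis .
qed

lemma expectation_traj_take:
  fixes f :: "(int \<times> int) list \<Rightarrow> real"
  shows "k \<le> n \<Longrightarrow> measure_pmf.expectation (traj n) (\<lambda>ss. f (take k ss)) = measure_pmf.expectation (traj k) f"
  using expectation_traj_take_drop[of k n f "\<lambda>_. 1"] by simp

lemma expectation_traj_drop:
  fixes f :: "(int \<times> int) list \<Rightarrow> real"
  shows "k \<le> n \<Longrightarrow> measure_pmf.expectation (traj n) (\<lambda>ss. f (drop k ss)) = measure_pmf.expectation (traj (n - k)) f"
  using expectation_traj_take_drop[of k n "\<lambda>_. 1" f] by simp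

definition return_prob :: "nat \<Rightarrow> real" where
  "return_prob n = measure_pmf.expectation (traj n) (\<lambda>ss. of_bool (sum_list ss = 0))"

lemma lazy_sum_Suc:
  "map_pmf (\<lambda>k. int k - int (Suc n)) (binomial_pmf (2 * Suc n) (1 / 2)) =
    do {a \<leftarrow> lazy_step; x \<leftarrow> map_pmf (\<lambda>k. int k - int n) (binomial_pmf (2 * n) (1 / 2)); return_pmf (a + x)}"
  by (simp add: lazy_step_def numeral_2_eq_2 binomial_pmf_Suc binomial_pmf_0 map_pmf_def bind_assoc_pmf
      bind_return_pmf algebra_simps)

lemma map_sum_list_traj:
  "map_pmf sum_list (traj n) =
    pair_pmf (map_pmf (\<lambda>k. int k - int n) (binomial_pmf (2 * n) (1 / 2)))
      (map_pmf (\<lambda>k. int k - int n) (binomial_pmf (2 * n) (1 / 2)))" (is "_ = pair_pmf (?X n) (?X n)")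
proof (induction n)
  case 0
  then show ?case
    by (simp add: binomial_pmf_0 zero_prod_def)
next
  case (Suc n)
  have "map_pmf sum_list (traj (Suc n)) =
      do {s \<leftarrow> planar_step; v \<leftarrow> map_pmf sum_list (traj n); return_pmf (s + v)}"
    by (simp add: map_pmf_def bind_assoc_pmf bind_return_pmf)
  also have "\<dots> = do {a \<leftarrow> lazy_step; b \<leftarrow> lazy_step; x \<leftarrow> ?X n; y \<leftarrow> ?X n; return_pmf (a + x, b + y)}"
    unfolding Suc by (simp add: planar_step_def pair_pmf_def bind_assoc_pmf bind_return_pmf)
  also have "\<dots> = do {a \<leftarrow> lazy_step; x \<leftarrow> ?X n; b \<leftarrow> lazy_step; y \<leftarrow> ?X n; return_pmf (a + x, b + y)}"
    by (rule bind_pmf_cong[OF refl bind_commute_pmf])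
  also have "\<dots> = pair_pmf (?X (Suc n)) (?X (Suc n))"
    unfolding lazy_sum_Suc by (simp only: pair_pmf_def bind_assoc_pmf bind_return_pmf)
  finally show ?case .
qed

text \<open>
  The two coordinates are independent, hence the square; it is of order \<open>1 / n\<close>, and the sum of these
  probabilities therefore grows like \<open>ln n\<close>. The size of the range and the number
  of collisions are both controlled through these sums.
\<close>

lemma return_prob_eq: "return_prob n = (real (2 * n choose n) / 4 ^ n)\<^sup>2"
proof -
  let ?X = "map_pmf (\<lambda>k. int k - int n) (binomial_pmf (2 * n) (1 / 2))"
  have "pmf ?X (int n - int n) = pmf (binomial_pmf (2 * n) (1 / 2)) n"
    by (rule pmf_map_inj') (simp add: inj_on_def)
  also have "\<dots> = real (2 * n choose n) / 4 ^ n"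
    by (simp add: power_mult_distrib[symmetric] power_divide power_add[symmetric] mult_2[symmetric]
        power_mult)
  finally have X: "pmf ?X 0 = real (2 * n choose n) / 4 ^ n" by simp
  have "(\<lambda>ss :: (int \<times> int) list. of_bool (sum_list ss = 0)) = (indicator (sum_list -` {0}) :: _ \<Rightarrow> real)"
    by (auto simp: indicator_def)
  then have "return_prob n = pmf (map_pmf sum_list (traj n)) (0, 0)"
    by (simp add: return_prob_def pmf_map zero_prod_def)
  also have "\<dots> = (real (2 * n choose n) / 4 ^ n)\<^sup>2"
    unfolding map_sum_list_traj pmf_pair X by (simp add: power2_eq_square)
  finally show ?thesis .
qed

lemma return_prob_Suc: "return_prob (Suc n) = return_prob n * ((2 * real n + 1) / (2 * real n + 2))\<^sup>2"
proof -
  have "Suc n * (2 * Suc n choose Suc n) = Suc n * (2 * (Suc (2 * n) choose n))"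
    using Suc_times_binomial[of n "Suc (2 * n)"] by simp
  then have 1: "2 * Suc n choose Suc n = 2 * (Suc (2 * n) choose Suc n)"
    using binomial_symmetric[of n "Suc (2 * n)"] by (simp only: mult_cancel1) simp
  have 2: "Suc n * (Suc (2 * n) choose Suc n) = Suc (2 * n) * (2 * n choose n)"
    by (rule Suc_times_binomial)
  have "(real n + 1) * real (2 * Suc n choose Suc n) = 2 * (2 * real n + 1) * real (2 * n choose n)"
    using arg_cong[OF 2, of real] unfolding 1 by (simp add: algebra_simps del: binomial_Suc_Suc)
  moreover have "c' / 4 ^ Suc n = c / 4 ^ n * ((2 * real n + 1) / (2 * real n + 2))"
    if "(real n + 1) * c' = 2 * (2 * real n + 1) * c" for c c' :: real
  proof -
    have "c' = 2 * (2 * real n + 1) * c / (real n + 1)"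
      using that by (simp add: field_simps)
    then show ?thesis by (simp add: divide_simps) (simp add: algebra_simps)
  qed
  ultimately have "real (2 * Suc n choose Suc n) / 4 ^ Suc n =
      real (2 * n choose n) / 4 ^ n * ((2 * real n + 1) / (2 * real n + 2))"
    by blast
  then show ?thesis
    unfolding return_prob_eq by (simp only: power_mult_distrib)
qed

lemma return_prob_0: "return_prob 0 = 1"
  by (simp add: return_prob_eq)

lemma return_prob_nonneg: "0 \<le> return_prob n"
  by (simp add: return_prob_eq)

lemma return_prob_le: "return_prob n \<le> 1 / (2 * real n + 1)"
proof (induction n)
  case (Suc n)
  have "return_prob (Suc n) \<le> 1 / (2 * real n + 1) * ((2 * real n + 1) / (2 * real n + 2))\<^sup>2"
    unfolding return_prob_Suc using Suc by (intro mult_right_mono) auto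
  also have "\<dots> = (2 * real n + 1) / (2 * real n + 2)\<^sup>2"
    by (simp add: power2_eq_square divide_simps)
  also have "\<dots> \<le> 1 / (2 * real n + 3)"
    by (simp add: power2_eq_square divide_simps) (simp add: algebra_simps)
  finally show ?case by (simp add: algebra_simps)
qed (simp add: return_prob_0)

lemma return_prob_Suc_ge: "1 / (4 * real (Suc n)) \<le> return_prob (Suc n)"
proof (induction n)
  case 0
  then show ?case by (simp add: return_prob_Suc return_prob_0 power2_eq_square)
next
  case (Suc n)
  have "1 / (4 * real (Suc (Suc n))) \<le> 1 / (4 * real (Suc n)) * ((2 * real (Suc n) + 1) / (2 * real (Suc n) + 2))\<^sup>2"
    by (simp add: power2_eq_square divide_simps) (simp add: algebra_simps)
  also have "\<dots> \<le> return_prob (Suc (Suc n))"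
    unfolding return_prob_Suc[of "Suc n"] using Suc by (intro mult_right_mono) auto
  finally show ?case .
qed

lemma sum_return_prob_le:
  assumes "n \<ge> 1"
  shows "(\<Sum>j=1..n. return_prob j) \<le> slog n / 2"
  using assms
proof (induction n rule: nat_induct_at_least)
  case base
  then show ?case using return_prob_le[of 1] by (simp add: slog_def)
next
  case (Suc n)
  have "ln (real n / (real n + 1)) \<le> real n / (real n + 1) - 1"
    using Suc.hyps by (intro ln_le_minus_one) auto
  then have "1 / (real n + 1) \<le> ln (real n + 1) - ln (real n)"
    using Suc.hyps by (simp add: ln_div field_simps)
  moreover have "return_prob (Suc n) * 2 \<le> 1 / (real n + 1)"
    using return_prob_le[of "Suc n"] return_prob_nonneg[of "Suc n"] by (simp add: field_simps)
  ultimately show ?case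
    using Suc.IH by (simp add: slog_def add.commute[of 1] del: of_nat_Suc) (simp add: add.commute)
qed

lemma sum_return_prob_ge:
  assumes "n \<ge> 1"
  shows "slog n / 8 \<le> (\<Sum>j\<le>n. return_prob j)"
proof -
  have "ln (real n) \<le> harm n"
    using ln_le_harm[of n] assms ln_mono[of "real n" "real n + 1"] by linarith
  moreover have "1 \<le> (harm n :: real)"
    using harm_mono[of 1 n, where 'a = real] assms by (simp add: harm_expand)
  ultimately have "slog n \<le> 2 * harm n"
    by (simp add: slog_def)
  moreover have "(\<Sum>j=1..n. 1 / (4 * real j)) = harm n / 4"
    by (simp add: harm_def sum_divide_distrib field_simps)
  ultimately have "slog n / 8 \<le> (\<Sum>j=1..n. 1 / (4 * real j))"
    by simp
  also have "\<dots> \<le> (\<Sum>j=1..n. return_prob j)"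
  proof (rule sum_mono)
    fix j assume "j \<in> {1..n}"
    then show "1 / (4 * real j) \<le> return_prob j"
      using return_prob_Suc_ge[of "j - 1"] by auto
  qed
  also have "\<dots> \<le> (\<Sum>j\<le>n. return_prob j)"
    by (intro sum_mono2) (auto simp: return_prob_nonneg)
  finally show ?thesis .
qed

section \<open>Range and collisions of a planar trajectory\<close>

primrec positions :: "(int \<times> int) list \<Rightarrow> (int \<times> int) list" where
  "positions [] = [0]"
| "positions (s # ss) = (s + sum_list ss) # positions ss"

lemma sum_list_in_positions: "sum_list ss \<in> set (positions ss)"
  by (cases ss) auto

lemma set_positions_eq: "set (positions ss) = (\<lambda>k. sum_list (drop k ss)) ` {..length ss}"
proof (induction ss)
  case (Cons s ss)
  then show ?case
    by (simp add: lessThan_Suc_atMost[symmetric] lessThan_Suc_eq_insert_0 image_image del: lessThan_Suc_atMost)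
qed simp

text \<open>
  The current position is visited for the first time.
\<close>

definition fresh :: "(int \<times> int) list \<Rightarrow> bool" where
  "fresh ss \<longleftrightarrow> (case ss of [] \<Rightarrow> True | s # ss' \<Rightarrow> s + sum_list ss' \<notin> set (positions ss'))"

lemma card_positions_eq:
  "card (set (positions ss)) = (\<Sum>k\<le>length ss. of_bool (fresh (drop k ss)))"
proof (induction ss)
  case Nil
  then show ?case by (simp add: fresh_def)
next
  case (Cons s ss)
  have "card (set (positions (s # ss))) = of_bool (fresh (s # ss)) + card (set (positions ss))"
    by (simp add: card_insert_if fresh_def)
  then show ?case
    by (simp add: Cons sum.atMost_Suc_shift del: sum_of_bool_eq sum.atMost_Suc)
qed

text \<open>
  The events \<open>the current site was first visited k steps ago\<close> are disjoint for different \<open>k\<close>.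
\<close>

lemma first_visit_unique:
  "(\<Sum>k\<le>length ss. of_bool (sum_list (take k ss) = 0) * of_bool (fresh (drop k ss))) \<le> (1 :: real)"
proof -
  let ?P = "\<lambda>k. k \<le> length ss \<and> sum_list (take k ss) = 0 \<and> fresh (drop k ss)"
  have no: False if "?P k" "?P l" "k < l" for k l
  proof -
    have "sum_list (drop k ss) = sum_list ss" "sum_list (drop l ss) = sum_list ss"
      using that append_take_drop_id[of k ss] append_take_drop_id[of l ss]
      by (metis add_0 sum_list_append)+
    moreover have "drop k ss = ss ! k # drop (Suc k) ss"
      using that by (intro Cons_nth_drop_Suc[symmetric]) auto
    moreover have "drop l ss = drop (l - Suc k) (drop (Suc k) ss)"
      using that by simp
    then have "sum_list (drop l ss) \<in> set (positions (drop (Suc k) ss))"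
      unfolding set_positions_eq using that
      by (intro image_eqI[of _ _ "l - Suc k"]) auto
    ultimately show False
      using that(1) by (simp add: fresh_def)
  qed
  have "(\<Sum>k\<le>length ss. of_bool (sum_list (take k ss) = 0) * of_bool (fresh (drop k ss))) =
      real (card {k. ?P k})"
    by (simp add: of_bool_conj[symmetric] Int_def)
  also have "\<dots> \<le> 1"
  proof -
    have "finite {k. ?P k}" by (rule finite_subset[of _ "{..length ss}"]) auto
    moreover have "k = l" if "?P k" "?P l" for k l
      using no[of k l] no[of l k] that by (metis linorder_neqE_nat)
    ultimately have "card {k. ?P k} \<le> Suc 0"
      by (subst card_le_Suc0_iff_eq) auto
    then show ?thesis by simp
  qed
  finally show ?thesis .
qed

text \<open>
  The expected range is the sum of the probabilities \<open>\<phi> t\<close> that time \<open>t\<close> visits a fresh site. By the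
  Markov property, \<open>return_prob k * \<phi> t\<close> is the probability that the site occupied at time \<open>t + k\<close> was
  first visited at time \<open>t\<close>; for a given \<open>t + k\<close> these add up to at most \<open>1\<close>. Summing over all times up to
  \<open>2 n\<close> bounds the product of the range and of the sum of the return probabilities, which is of order \<open>ln n\<close>.
\<close>

lemma expected_range_le:
  assumes "n \<ge> 1"
  shows "measure_pmf.expectation (traj n) (\<lambda>ss. real (card (set (positions ss)))) \<le> 24 * n / slog n"
proof -
  define \<phi> :: "nat \<Rightarrow> real" where "\<phi> t = measure_pmf.expectation (traj t) (\<lambda>ss. of_bool (fresh ss))" for t
  have \<phi>_nonneg: "0 \<le> \<phi> t" for t
    by (simp add: \<phi>_def)
  have range: "measure_pmf.expectation (traj n) (\<lambda>ss. real (card (set (positions ss)))) = (\<Sum>t\<le>n. \<phi> t)"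
  proof -
    have "measure_pmf.expectation (traj n) (\<lambda>ss. real (card (set (positions ss)))) =
        measure_pmf.expectation (traj n) (\<lambda>ss. \<Sum>k\<le>n. of_bool (fresh (drop k ss)))"
      by (intro expectation_cong) (simp add: card_positions_eq length_traj)
    also have "\<dots> = (\<Sum>k\<le>n. measure_pmf.expectation (traj n) (\<lambda>ss. of_bool (fresh (drop k ss))))"
      by (intro Bochner_Integration.integral_sum integrable_measure_pmf_finite finite_traj)
    also have "\<dots> = (\<Sum>k\<le>n. \<phi> (n - k))"
      unfolding \<phi>_def by (intro sum.cong refl expectation_traj_drop) auto
    also have "\<dots> = (\<Sum>t\<le>n. \<phi> t)"
      by (rule sum.reindex_bij_witness[of _ "\<lambda>t. n - t" "\<lambda>t. n - t"]) auto
    finally show ?thesis .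
  qed
  have renewal: "(\<Sum>k\<le>s. return_prob k * \<phi> (s - k)) \<le> 1" for s
  proof -
    have "(\<Sum>k\<le>s. return_prob k * \<phi> (s - k)) = (\<Sum>k\<le>s. measure_pmf.expectation (traj s)
        (\<lambda>ss. of_bool (sum_list (take k ss) = 0) * of_bool (fresh (drop k ss))))"
      unfolding \<phi>_def return_prob_def
      by (intro sum.cong refl expectation_traj_take_drop[symmetric]) auto
    also have "\<dots> = measure_pmf.expectation (traj s)
        (\<lambda>ss. \<Sum>k\<le>s. of_bool (sum_list (take k ss) = 0) * of_bool (fresh (drop k ss)))"
      by (intro Bochner_Integration.integral_sum[symmetric] integrable_measure_pmf_finite finite_traj)
    also have "\<dots> \<le> measure_pmf.expectation (traj s) (\<lambda>ss. 1)"
      using first_visit_unique by (intro expectation_mono_finite finite_traj) (metis length_traj)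
    finally show ?thesis by simp
  qed
  have "(\<Sum>k\<le>n. return_prob k) * (\<Sum>t\<le>n. \<phi> t) = (\<Sum>(k, t)\<in>{..n} \<times> {..n}. return_prob k * \<phi> t)"
    by (simp add: sum_product sum.cartesian_product)
  also have "\<dots> \<le> (\<Sum>(k, t)\<in>{(k, t). k + t \<le> 2 * n}. return_prob k * \<phi> t)"
  proof (rule sum_mono2)
    show "finite {(k, t). k + t \<le> 2 * n}"
      by (rule finite_subset[of _ "{..2 * n} \<times> {..2 * n}"]) auto
  qed (auto simp: return_prob_nonneg \<phi>_nonneg)
  also have "\<dots> = (\<Sum>s\<le>2 * n. \<Sum>k\<le>s. return_prob k * \<phi> (s - k))"
    by (rule sum.triangle_reindex_eq)
  also have "\<dots> \<le> (\<Sum>s\<le>2 * n. 1)"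
    by (intro sum_mono renewal)
  also have "\<dots> \<le> 3 * real n"
    using assms by simp
  finally have "(\<Sum>k\<le>n. return_prob k) * (\<Sum>t\<le>n. \<phi> t) \<le> 3 * real n" .
  moreover have "slog n / 8 * (\<Sum>t\<le>n. \<phi> t) \<le> (\<Sum>k\<le>n. return_prob k) * (\<Sum>t\<le>n. \<phi> t)"
    by (intro mult_right_mono sum_return_prob_ge assms sum_nonneg \<phi>_nonneg)
  ultimately have "slog n * (\<Sum>t\<le>n. \<phi> t) \<le> 24 * real n"
    by simp
  then show ?thesis
    unfolding range using slog_ge_1[of "real n"] assms by (simp add: field_simps)
qed

text \<open>
  How often the lamp at \<open>x\<close> is switched: every step switches the lamp at its starting point and the
  one at its end point. Hence two switches per step, and an intermediate visit to a site counts twice.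
\<close>

primrec visits :: "(int \<times> int) list \<Rightarrow> int \<times> int \<Rightarrow> nat" where
  "visits [] x = 0"
| "visits (s # ss) x = visits ss x + of_bool (x = sum_list ss) + of_bool (x = s + sum_list ss)"

lemma sum_visits:
  assumes "finite A" "set (positions ss) \<subseteq> A"
  shows "(\<Sum>x\<in>A. visits ss x) = 2 * length ss"
  using assms(2)
proof (induction ss)
  case (Cons s ss)
  then have A: "sum_list ss \<in> A" "s + sum_list ss \<in> A"
    using sum_list_in_positions[of ss] by auto
  have "(\<Sum>x\<in>A. of_bool (x = y)) = (1 :: nat)" if "y \<in> A" for y
    using that assms(1) by (simp add: of_bool_def)
  with A Cons show ?case
    by (simp add: sum.distrib)
qed simp

lemma visits_eq_0: "x \<notin> set (positions ss) \<Longrightarrow> visits ss x = 0"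
proof (induction ss)
  case (Cons s ss)
  then have "x \<noteq> sum_list ss"
    using sum_list_in_positions[of ss] by auto
  with Cons show ?case by simp
qed simp

lemma visits_pos: "x \<in> set (positions ss) \<Longrightarrow> ss \<noteq> [] \<Longrightarrow> 0 < visits ss x"
proof (induction ss)
  case (Cons s ss)
  then show ?case by (cases "ss = []") auto
qed simp

lemma visits_eq:
  "visits ss x + of_bool (x = sum_list ss) + of_bool (x = 0) = 2 * count_list (positions ss) x"
  by (induction ss) auto

text \<open>
  The number of pairs of times at which the walk is at the same site.
\<close>

definition energy :: "(int \<times> int) list \<Rightarrow> nat" where
  "energy ss = (\<Sum>x\<in>set (positions ss). (count_list (positions ss) x)\<^sup>2)"

text \<open>
  The number of earlier times at which the walk was at its current position.
\<close>

definition returns :: "(int \<times> int) list \<Rightarrow> nat" where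
  "returns ss = (\<Sum>j=1..length ss. of_bool (sum_list (take j ss) = 0))"

lemma count_positions_eq: "count_list (positions ss) x = (\<Sum>k\<le>length ss. of_bool (sum_list (drop k ss) = x))"
  by (induction ss) (auto simp: sum.atMost_Suc_shift simp del: sum_of_bool_eq sum.atMost_Suc)

lemma count_positions_eq_returns: "count_list (positions ss) (s + sum_list ss) = returns (s # ss)"
proof -
  have "sum_list (drop k ss) = s + sum_list ss \<longleftrightarrow> s + sum_list (take k ss) = 0" for k
  proof -
    have "sum_list ss = sum_list (take k ss) + sum_list (drop k ss)"
      using sum_list_append[of "take k ss" "drop k ss"] by simp
    then show ?thesis by (auto simp: algebra_simps)
  qed
  then have "count_list (positions ss) (s + sum_list ss) =
      (\<Sum>k\<le>length ss. of_bool (sum_list (take (Suc k) (s # ss)) = 0))"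
    by (simp add: count_positions_eq del: sum_of_bool_eq)
  also have "\<dots> = returns (s # ss)"
    unfolding returns_def
    by (rule sum.reindex_bij_witness[of _ "\<lambda>j. j - 1" Suc]) auto
  finally show ?thesis .
qed

lemma energy_Cons: "energy (s # ss) = energy ss + 2 * returns (s # ss) + 1"
proof -
  let ?y = "s + sum_list ss" and ?A = "set (positions (s # ss))"
  let ?c = "count_list (positions ss)"
  have "energy (s # ss) = (\<Sum>x\<in>?A. (?c x)\<^sup>2 + (if x = ?y then 2 * ?c ?y + 1 else 0))"
    unfolding energy_def by (intro sum.cong) (auto simp: power2_eq_square)
  also have "\<dots> = (\<Sum>x\<in>?A. (?c x)\<^sup>2) + (2 * ?c ?y + 1)"
    by (simp add: sum.distrib)
  also have "(\<Sum>x\<in>?A. (?c x)\<^sup>2) = energy ss"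
    unfolding energy_def by (rule sum.mono_neutral_right) (auto simp: count_list_0_iff)
  finally show ?thesis
    by (simp add: count_positions_eq_returns)
qed

lemma expected_returns: "measure_pmf.expectation (traj n) (\<lambda>ss. real (returns ss)) = (\<Sum>j=1..n. return_prob j)"
proof -
  have "measure_pmf.expectation (traj n) (\<lambda>ss. real (returns ss)) =
      measure_pmf.expectation (traj n) (\<lambda>ss. \<Sum>j=1..n. of_bool (sum_list (take j ss) = 0))"
    by (intro expectation_cong) (simp add: returns_def length_traj)
  also have "\<dots> = (\<Sum>j=1..n. measure_pmf.expectation (traj n) (\<lambda>ss. of_bool (sum_list (take j ss) = 0)))"
    by (intro Bochner_Integration.integral_sum integrable_measure_pmf_finite finite_traj)
  also have "\<dots> = (\<Sum>j=1..n. return_prob j)"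
    unfolding return_prob_def by (intro sum.cong refl expectation_traj_take) auto
  finally show ?thesis .
qed

text \<open>
  Each new step adds collisions with the earlier visits to its end point, and their expected number is
  a sum of return probabilities.
\<close>

lemma expected_energy_le:
  "measure_pmf.expectation (traj n) (\<lambda>ss. real (energy ss)) \<le> 1 + n * (1 + 2 * (\<Sum>j=1..n. return_prob j))"
proof (induction n)
  case 0
  then show ?case by (simp add: energy_def)
next
  case (Suc n)
  have int: "integrable (traj (Suc n)) f" for f :: "_ \<Rightarrow> real"
    by (intro integrable_measure_pmf_finite finite_traj)
  have "measure_pmf.expectation (traj (Suc n)) (\<lambda>ss. real (energy ss)) =
      measure_pmf.expectation (traj (Suc n)) (\<lambda>ss. real (energy (drop 1 ss)) + (2 * real (returns ss) + 1))"
  proof (rule expectation_cong)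
    fix ss assume "ss \<in> set_pmf (traj (Suc n))"
    then obtain s ss' where "ss = s # ss'"
      by (metis length_traj length_Suc_conv)
    then show "real (energy ss) = real (energy (drop 1 ss)) + (2 * real (returns ss) + 1)"
      by (simp add: energy_Cons)
  qed
  also have "\<dots> = measure_pmf.expectation (traj (Suc n)) (\<lambda>ss. real (energy (drop 1 ss))) +
      (2 * measure_pmf.expectation (traj (Suc n)) (\<lambda>ss. real (returns ss)) + 1)"
    by (simp add: int del: replicate_pmf.simps)
  also have "\<dots> = measure_pmf.expectation (traj n) (\<lambda>ss. real (energy ss)) + (1 + 2 * (\<Sum>j=1..Suc n. return_prob j))"
    unfolding expected_returns
    using expectation_traj_drop[of 1 "Suc n" "\<lambda>ss. real (energy ss)"] by simp
  also have "\<dots> \<le> 1 + n * (1 + 2 * (\<Sum>j=1..Suc n. return_prob j)) + (1 + 2 * (\<Sum>j=1..Suc n. return_prob j))"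
    by (rule add_right_mono, rule order_trans[OF Suc])
      (intro add_left_mono mult_left_mono, auto simp: return_prob_nonneg)
  finally show ?case
    by (simp add: algebra_simps)
qed

lemma expected_sum_visits_squared_le:
  assumes "n \<ge> 1" "finite A" "\<And>ss. ss \<in> set_pmf (traj n) \<Longrightarrow> set (positions ss) \<subseteq> A"
  shows "measure_pmf.expectation (traj n) (\<lambda>ss. \<Sum>x\<in>A. (real (visits ss x))\<^sup>2) \<le> 12 * real n * slog n"
proof -
  have le: "(\<Sum>x\<in>A. (real (visits ss x))\<^sup>2) \<le> 4 * real (energy ss)" if "ss \<in> set_pmf (traj n)" for ss
  proof -
    have "(\<Sum>x\<in>A. (real (visits ss x))\<^sup>2) = (\<Sum>x\<in>set (positions ss). (real (visits ss x))\<^sup>2)"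
      using assms(2) assms(3)[OF that] by (intro sum.mono_neutral_right) (auto simp: visits_eq_0)
    also have "\<dots> \<le> (\<Sum>x\<in>set (positions ss). (real (2 * count_list (positions ss) x))\<^sup>2)"
    proof (intro sum_mono power_mono)
      fix x show "real (visits ss x) \<le> real (2 * count_list (positions ss) x)"
        using visits_eq[of ss x] by linarith
    qed simp
    also have "\<dots> = 4 * real (energy ss)"
      by (simp add: energy_def power_mult_distrib sum_distrib_left)
    finally show ?thesis .
  qed
  have "measure_pmf.expectation (traj n) (\<lambda>ss. \<Sum>x\<in>A. (real (visits ss x))\<^sup>2) \<le>
      measure_pmf.expectation (traj n) (\<lambda>ss. 4 * real (energy ss))"
    using le by (intro expectation_mono_finite finite_traj)
  also have "\<dots> \<le> 4 * (1 + n * (1 + 2 * (\<Sum>j=1..n. return_prob j)))"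
    using expected_energy_le[of n] by simp
  also have "\<dots> \<le> 4 * (1 + n * (1 + slog n))"
    using sum_return_prob_le[OF assms(1)] by (intro mult_left_mono add_left_mono) auto
  also have "\<dots> \<le> 12 * real n * slog n"
  proof -
    have "1 * 1 \<le> real n * slog n" "real n * 1 \<le> real n * slog n"
      using slog_ge_1[of "real n"] assms(1) by (intro mult_mono mult_left_mono; simp)+
    then show ?thesis by (simp add: algebra_simps)
  qed
  finally show ?thesis .
qed

lemma positions_append_subset: "set (positions vs) \<subseteq> set (positions (us @ vs))"
  by (induction us) auto

lemma positions_insert_detour:
  "set (positions (us @ [- s, s] @ vs)) = insert (s + sum_list vs) (set (positions (us @ vs)))"
  using sum_list_in_positions[of vs] positions_append_subset[of vs]
  by (induction us) (auto simp: insert_commute)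

text \<open>
  The visited set can be covered by a walk whose length is linear in the size of the set, however long
  the original walk is: a tour of the sites seen so far passes through the current site, and a step to a new site
  is appended as a detour of length two. Hence there are only exponentially many sets of \<open>r\<close> sites that can be a range.
\<close>

lemma covering_tour:
  assumes "set ss \<subseteq> set_pmf planar_step"
  shows "\<exists>us. set us \<subseteq> set_pmf planar_step \<and> set (positions us) = set (positions ss) \<and>
    length us + 2 \<le> 2 * card (set (positions ss))"
  using assms
proof (induction ss)
  case Nil
  then show ?case by (intro exI[of _ "[]"]) simp
next
  case (Cons s ss)
  then obtain us where us: "set us \<subseteq> set_pmf planar_step" "set (positions us) = set (positions ss)"
    "length us + 2 \<le> 2 * card (set (positions ss))"
    by auto
  show ?case
  proof (cases "s + sum_list ss \<in> set (positions ss)")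
    case True
    with us show ?thesis
      by (intro exI[of _ us]) (auto simp: insert_absorb)
  next
    case False
    \<comment> \<open>The tour passes through the current site after its first \<open>length (drop k us)\<close> steps; there the steps
      \<open>s\<close> and \<open>- s\<close> are inserted.\<close>
    have "sum_list ss \<in> set (positions us)"
      using sum_list_in_positions[of ss] us(2) by simp
    then obtain k where "sum_list (drop k us) = sum_list ss"
      unfolding set_positions_eq[of us] by auto
    then have pos: "set (positions (take k us @ [- s, s] @ drop k us)) = insert (s + sum_list ss) (set (positions ss))"
      using us(2) by (simp only: positions_insert_detour append_take_drop_id)
    have "set (take k us @ [- s, s] @ drop k us) \<subseteq> set_pmf planar_step"
      using us(1) Cons.prems set_take_subset[of k us] set_drop_subset[of k us] uminus_planar_step by auto
    moreover have "length (take k us @ [- s, s] @ drop k us) + 2 \<le> 2 * card (insert (s + sum_list ss) (set (positions ss)))"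
      using us(3) False by simp
    ultimately show ?thesis
      using pos by (intro exI[of _ "take k us @ [- s, s] @ drop k us"]) auto
  qed
qed

section \<open>Convolution powers\<close>

lemma cross_entropy_self_nonneg: "0 \<le> cross_entropy p p"
  unfolding cross_entropy_def
  by (rule integral_nonneg_AE) (auto simp: AE_measure_pmf_iff pmf_positive pmf_le_1 ln_le_zero_iff)

lemma set_conv_power:
  assumes "group G" "set_pmf \<mu> \<subseteq> carrier G"
  shows "set_pmf (conv_power G \<mu> n) \<subseteq> carrier G"
proof -
  interpret group G by fact
  show ?thesis
    using assms(2) by (induction n) auto
qed

lemma finite_conv_power: "finite (set_pmf \<mu>) \<Longrightarrow> finite (set_pmf (conv_power G \<mu> n))"
  by (induction n) auto

text \<open>
  Multiplying by the new increment on the left keeps the lamps in a fixed frame: a left factor acts on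
  the lamp at the position of the lamplighter, whereas a right factor shifts all lamps.
\<close>

lemma conv_power_Suc_left:
  assumes "group G" "set_pmf \<mu> \<subseteq> carrier G"
  shows "conv_power G \<mu> (Suc n) = do {x \<leftarrow> \<mu>; y \<leftarrow> conv_power G \<mu> n; return_pmf (x \<otimes>\<^bsub>G\<^esub> y)}"
proof -
  interpret G: group G by fact
  have right: "conv_power G \<mu> (Suc m) = do {y \<leftarrow> conv_power G \<mu> m; z \<leftarrow> \<mu>; return_pmf (y \<otimes>\<^bsub>G\<^esub> z)}" for m
    by (simp add: map_pmf_def pair_pmf_def bind_assoc_pmf bind_return_pmf)
  show ?thesis
  proof (induction n)
    case 0
    have "conv_power G \<mu> (Suc 0) = do {z \<leftarrow> \<mu>; return_pmf (\<one>\<^bsub>G\<^esub> \<otimes>\<^bsub>G\<^esub> z)}"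
      unfolding right by (simp add: bind_return_pmf)
    also have "\<dots> = do {z \<leftarrow> \<mu>; return_pmf (z \<otimes>\<^bsub>G\<^esub> \<one>\<^bsub>G\<^esub>)}"
      using assms(2) by (intro bind_pmf_cong) auto
    finally show ?case by (simp add: bind_return_pmf)
  next
    case (Suc n)
    have "conv_power G \<mu> (Suc (Suc n)) =
        do {x \<leftarrow> \<mu>; y \<leftarrow> conv_power G \<mu> n; z \<leftarrow> \<mu>; return_pmf (x \<otimes>\<^bsub>G\<^esub> y \<otimes>\<^bsub>G\<^esub> z)}"
      unfolding right[of "Suc n"] Suc by (simp add: bind_assoc_pmf bind_return_pmf)
    also have "\<dots> = do {x \<leftarrow> \<mu>; y \<leftarrow> conv_power G \<mu> n; z \<leftarrow> \<mu>; return_pmf (x \<otimes>\<^bsub>G\<^esub> (y \<otimes>\<^bsub>G\<^esub> z))}"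
      using assms(2) set_conv_power[OF assms, of n] by (intro bind_pmf_cong refl) (auto simp: G.m_assoc subset_iff)
    also have "\<dots> = do {x \<leftarrow> \<mu>; y \<leftarrow> conv_power G \<mu> (Suc n); return_pmf (x \<otimes>\<^bsub>G\<^esub> y)}"
      unfolding right by (simp add: bind_assoc_pmf bind_return_pmf)
    finally show ?case .
  qed
qed

section \<open>The switch-walk-switch walk on a wreath product\<close>

locale lamplighter = group D for D :: "('d, 'k) monoid_scheme" (structure) +
  fixes \<nu> :: "'d pmf"
  assumes walk: "random_walk_measure D \<nu>" and one_in_support: "\<one> \<in> set_pmf \<nu>"
begin

lemma support: "set_pmf \<nu> \<subseteq> carrier D" "finite (set_pmf \<nu>)" "generate D (set_pmf \<nu>) = carrier D"
  and pmf_inv: "a \<in> carrier D \<Longrightarrow> pmf \<nu> (inv a) = pmf \<nu> a"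
  using walk by (auto simp: random_walk_measure_def)

abbreviation "W \<equiv> wreath Z2 D"

lemma W_group: "group W"
  by (intro group_wreath group_Z2 is_group)

sublocale W: group W
  by (rule W_group)

lemma W_carrier: "(c, f) \<in> carrier W \<longleftrightarrow> (\<forall>x. f x \<in> carrier D) \<and> finite {x. f x \<noteq> \<one>}"
  by (auto simp: wreath_def Let_def carrier_sum_group is_group PiE_UNIV_domain)

lemma W_mult: "(c, f) \<otimes>\<^bsub>W\<^esub> (d, g) = (c + d, \<lambda>x. f (x - d) \<otimes> g x)"
  by (cases c; cases d) (auto simp: wreath_def Let_def shift_def group_integer_group fun_eq_iff)

lemma W_one: "\<one>\<^bsub>W\<^esub> = (0, \<lambda>_. \<one>)"
  by (auto simp: wreath_def Let_def zero_prod_def fun_eq_iff)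

definition single :: "int \<times> int \<Rightarrow> 'd \<Rightarrow> int \<times> int \<Rightarrow> 'd" where
  "single c a = (\<lambda>_. \<one>)(c := a)"

text \<open>
  The product of a lamp \<open>a\<close> at the origin, a move \<open>s\<close> and a lamp \<open>b\<close> at the origin. As a left factor it
  switches the current lamp by \<open>b\<close>, moves by \<open>s\<close> and switches the lamp at the new position by \<open>a\<close>.
\<close>

definition switch_step :: "(int \<times> int) \<times> 'd \<times> 'd \<Rightarrow> (int \<times> int) \<times> (int \<times> int \<Rightarrow> 'd)" where
  "switch_step = (\<lambda>(s, a, b). (s, \<lambda>x. single s a x \<otimes> single 0 b x))"

lemma switch_step_carrier:
  assumes "a \<in> carrier D" "b \<in> carrier D"
  shows "switch_step (s, a, b) \<in> carrier W"
proof -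
  have "finite {x. single s a x \<otimes> single 0 b x \<noteq> \<one>}"
    by (rule finite_subset[of _ "{s, 0}"]) (auto simp: single_def)
  then show ?thesis
    using assms by (simp add: switch_step_def W_carrier single_def)
qed

definition touch :: "int \<times> int \<Rightarrow> 'd \<Rightarrow> (int \<times> int \<Rightarrow> 'd) \<Rightarrow> int \<times> int \<Rightarrow> 'd" where
  "touch c a f = f(c := a \<otimes> f c)"

lemma switch_step_mult:
  assumes "a \<in> carrier D" "b \<in> carrier D" "\<And>x. f x \<in> carrier D"
  shows "switch_step (s, a, b) \<otimes>\<^bsub>W\<^esub> (c, f) = (s + c, touch (s + c) a (touch c b f))"
  using assms by (auto simp: touch_def switch_step_def W_mult single_def fun_eq_iff m_assoc)

lemma inv_switch_step:
  assumes "a \<in> carrier D" "b \<in> carrier D"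
  shows "inv\<^bsub>W\<^esub> (switch_step (s, a, b)) = switch_step (- s, inv b, inv a)"
proof (rule W.inv_equality)
  have "switch_step (- s, inv b, inv a) \<otimes>\<^bsub>W\<^esub> switch_step (s, a, b) =
      switch_step (- s, inv b, inv a) \<otimes>\<^bsub>W\<^esub> (s, \<lambda>x. single s a x \<otimes> single 0 b x)"
    by (simp add: switch_step_def)
  also have "\<dots> = \<one>\<^bsub>W\<^esub>"
    using assms by (subst switch_step_mult)
      (auto simp: touch_def W_one fun_eq_iff single_def m_assoc[symmetric])
  finally show "switch_step (- s, inv b, inv a) \<otimes>\<^bsub>W\<^esub> switch_step (s, a, b) = \<one>\<^bsub>W\<^esub>" .
qed (use assms in \<open>auto intro: switch_step_carrier\<close>)

definition \<mu> :: "((int \<times> int) \<times> (int \<times> int \<Rightarrow> 'd)) pmf" where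
  "\<mu> = map_pmf switch_step (pair_pmf planar_step (pair_pmf \<nu> \<nu>))"

lemma set_mu: "set_pmf \<mu> = switch_step ` (set_pmf planar_step \<times> set_pmf \<nu> \<times> set_pmf \<nu>)"
  by (simp add: \<mu>_def)

lemma mu_carrier: "set_pmf \<mu> \<subseteq> carrier W"
  using support(1) by (auto simp: set_mu subset_iff intro!: switch_step_carrier)

lemma finite_mu: "finite (set_pmf \<mu>)"
  using support(2) by (simp add: set_mu set_planar_step)

lemma switch_step_in_mu:
  "s \<in> set_pmf planar_step \<Longrightarrow> a \<in> set_pmf \<nu> \<Longrightarrow> b \<in> set_pmf \<nu> \<Longrightarrow> switch_step (s, a, b) \<in> set_pmf \<mu>"
  by (auto simp: set_mu)

lemma one_in_mu: "\<one>\<^bsub>W\<^esub> \<in> set_pmf \<mu>"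
proof -
  have "\<one>\<^bsub>W\<^esub> = switch_step (0, \<one>, \<one>)"
    by (simp add: W_one switch_step_def single_def)
  then show ?thesis
    using switch_step_in_mu[of 0 \<one> \<one>] one_in_support by (simp add: set_planar_step zero_prod_def)
qed

lemma map_inv_nu: "map_pmf (m_inv D) \<nu> = \<nu>"
proof (rule pmf_eqI)
  fix a
  show "pmf (map_pmf (m_inv D) \<nu>) a = pmf \<nu> a"
  proof (cases "a \<in> carrier D")
    case True
    have "(\<lambda>x. inv x) -` {a} \<inter> set_pmf \<nu> = {inv a} \<inter> set_pmf \<nu>"
      using True support(1) by (auto simp: subset_iff)
    then have "measure \<nu> ((\<lambda>x. inv x) -` {a}) = measure \<nu> {inv a}"
      by (metis measure_Int_set_pmf)
    then show ?thesis
      using pmf_inv[OF True] by (simp add: pmf_map measure_pmf_single)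
  next
    case False
    then have "a \<notin> set_pmf \<nu>" "a \<notin> (\<lambda>x. inv x) ` set_pmf \<nu>"
      using support(1) by auto
    then show ?thesis
      by (simp add: pmf_map_outside set_pmf_iff)
  qed
qed

text \<open>
  Inversion reverses the order of the three factors and inverts each of them, and all three
  distributions are symmetric.
\<close>

lemma map_inv_mu: "map_pmf (m_inv W) \<mu> = \<mu>"
proof -
  have "map_pmf (m_inv W) \<mu> = map_pmf (\<lambda>(s, a, b). switch_step (- s, inv b, inv a)) (pair_pmf planar_step (pair_pmf \<nu> \<nu>))"
    unfolding \<mu>_def pmf.map_comp using support(1)
    by (intro map_pmf_cong refl) (auto simp: inv_switch_step subset_iff)
  also have "\<dots> = map_pmf switch_step (map_pmf (\<lambda>(s, ab). (- s, (\<lambda>(a, b). (b, a)) ((\<lambda>(a, b). (inv a, inv b)) ab)))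
      (pair_pmf planar_step (pair_pmf \<nu> \<nu>)))"
    unfolding pmf.map_comp by (intro map_pmf_cong refl) auto
  also have "map_pmf (\<lambda>(s, ab). (- s, (\<lambda>(a, b). (b, a)) ((\<lambda>(a, b). (inv a, inv b)) ab)))
      (pair_pmf planar_step (pair_pmf \<nu> \<nu>)) = pair_pmf planar_step (pair_pmf \<nu> \<nu>)"
    unfolding map_pair map_uminus_planar_step pmf.map_comp[unfolded o_def, symmetric] map_inv_nu
    by (simp only: pair_commute_pmf[symmetric])
  finally show ?thesis
    by (simp only: \<mu>_def)
qed

lemma pmf_mu_inv:
  assumes "g \<in> carrier W"
  shows "pmf \<mu> (inv\<^bsub>W\<^esub> g) = pmf \<mu> g"
proof -
  have "m_inv W -` {inv\<^bsub>W\<^esub> g} \<inter> set_pmf \<mu> = {g} \<inter> set_pmf \<mu>"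
    using assms mu_carrier by (auto simp: subset_iff)
  then have "measure \<mu> (m_inv W -` {inv\<^bsub>W\<^esub> g}) = measure \<mu> {g}"
    by (metis measure_Int_set_pmf)
  then have "pmf (map_pmf (m_inv W) \<mu>) (inv\<^bsub>W\<^esub> g) = pmf \<mu> g"
    by (simp add: pmf_map measure_pmf_single)
  then show ?thesis
    by (simp only: map_inv_mu)
qed

text \<open>
  Since \<open>\<one>\<close> lies in the support of \<open>\<nu>\<close> and \<open>0\<close> in that of the planar step, pure moves and pure switches at
  the origin are available. Conjugation by moves gives switches everywhere, and these generate all finite
  lamp configurations.
\<close>

lemma generate_mu: "generate W (set_pmf \<mu>) = carrier W"
proof
  let ?H = "generate W (set_pmf \<mu>)"
  show "?H \<subseteq> carrier W"
    using mu_carrier by (rule W.generate_incl)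
  have mult: "g \<otimes>\<^bsub>W\<^esub> h \<in> ?H" if "g \<in> ?H" "h \<in> ?H" for g h
    using that by (rule generate.eng)
  have one: "(0, \<lambda>_. \<one>) \<in> ?H"
    using generate.one[of W "set_pmf \<mu>"] by (simp add: W_one)
  have zero: "0 \<in> set_pmf planar_step"
    by (simp add: set_planar_step zero_prod_def)
  have step: "(s, \<lambda>_. \<one>) \<in> ?H" if "s \<in> set_pmf planar_step" for s
    using generate.incl[OF switch_step_in_mu[OF that one_in_support one_in_support], of W]
    by (simp add: switch_step_def single_def)
  have steps: "(sum_list ss, \<lambda>_. \<one>) \<in> ?H" if "set ss \<subseteq> set_pmf planar_step" for ss
    using that
  proof (induction ss)
    case (Cons s ss)
    then show ?case
      using mult[OF step[of s] Cons.IH] by (simp add: W_mult)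
  qed (simp add: one)
  have move: "(c, \<lambda>_. \<one>) \<in> ?H" for c
  proof -
    obtain k l where c: "c = (k, l)" by (cases c)
    have rep: "sum_list (replicate n s) = (int n * fst s, int n * snd s)" for n and s :: "int \<times> int"
      by (induction n) (auto simp: zero_prod_def algebra_simps prod_eq_iff)
    have sub: "set (replicate (nat \<bar>k\<bar>) (sgn k, 0) @ replicate (nat \<bar>l\<bar>) (0, sgn l)) \<subseteq> set_pmf planar_step"
      by (auto simp: set_planar_step sgn_if set_replicate_conv_if)
    show ?thesis
      using steps[OF sub] by (simp add: c rep abs_mult_sgn)
  qed
  have switch_step_0: "switch_step (0, a, \<one>) = (0, single 0 a)" if "a \<in> carrier D" for a
    using that by (auto simp: switch_step_def single_def fun_eq_iff)
  have lamp0: "(0, single 0 a) \<in> ?H" if "a \<in> carrier D" for a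
  proof -
    have "a \<in> generate D (set_pmf \<nu>)"
      using that support(3) by simp
    then show ?thesis
    proof (induction a rule: generate.induct)
      case one
      then show ?case
        using \<open>(0, \<lambda>_. \<one>) \<in> ?H\<close> by (simp add: single_def)
    next
      case (incl a)
      then show ?case
        using generate.incl[OF switch_step_in_mu[OF zero incl one_in_support], of W] support(1)
        by (simp add: switch_step_0 subset_iff)
    next
      case (inv a)
      then have "inv a \<in> set_pmf \<nu>"
        using pmf_inv[of a] support(1) by (auto simp: set_pmf_iff)
      then show ?case
        using generate.incl[OF switch_step_in_mu[OF zero _ one_in_support], of "inv a" W] support(1) inv
        by (simp add: switch_step_0 subset_iff)
    next
      case (eng a b)
      have "(0, single 0 a) \<otimes>\<^bsub>W\<^esub> (0, single 0 b) = (0, single 0 (a \<otimes> b))"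
        by (auto simp: W_mult single_def fun_eq_iff)
      then show ?case
        using mult[OF eng.IH] by simp
    qed
  qed
  have lamp: "(0, single c a) \<in> ?H" if "a \<in> carrier D" for a c
  proof -
    have "(- c, \<lambda>_. \<one>) \<otimes>\<^bsub>W\<^esub> (0, single 0 a) \<otimes>\<^bsub>W\<^esub> (c, \<lambda>_. \<one>) = (0, single c a)"
      using that by (auto simp: W_mult single_def fun_eq_iff)
    then show ?thesis
      using mult[OF mult[OF move lamp0[OF that]] move, of "- c" c] by simp
  qed
  have lamps: "(0, f) \<in> ?H" if "finite A" "{x. f x \<noteq> \<one>} \<subseteq> A" "\<forall>x. f x \<in> carrier D" for f A
    using that
  proof (induction A arbitrary: f rule: finite_induct)
    case empty
    then have "f = (\<lambda>_. \<one>)" by auto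
    then show ?case using one by simp
  next
    case (insert c A)
    have "(0, f(c := \<one>)) \<in> ?H"
      using insert.prems by (intro insert.IH) auto
    moreover have "(0, single c (f c)) \<otimes>\<^bsub>W\<^esub> (0, f(c := \<one>)) = (0, f)"
      using insert.prems by (auto simp: W_mult single_def fun_eq_iff)
    ultimately show ?case
      using mult[OF lamp[of "f c" c]] insert.prems by metis
  qed
  show "carrier W \<subseteq> ?H"
  proof
    fix g assume g: "g \<in> carrier W"
    obtain c f where cf: "g = (c, f)" by (cases g)
    have f: "\<forall>x. f x \<in> carrier D" "finite {x. f x \<noteq> \<one>}"
      using g by (simp_all add: cf W_carrier)
    have "(c, \<lambda>_. \<one>) \<otimes>\<^bsub>W\<^esub> (0, f) = g"
    proof -
      have "f x \<in> carrier D" for x using f(1) by blast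
      then show ?thesis by (simp add: cf W_mult fun_eq_iff)
    qed
    then show "g \<in> ?H"
      using mult[OF move lamps[OF f(2) order_refl f(1)], of c] by simp
  qed
qed

lemma random_walk_mu: "random_walk_measure W \<mu>"
  unfolding random_walk_measure_def
  using mu_carrier finite_mu pmf_mu_inv generate_mu by blast

section \<open>Lamps are independent given the trajectory\<close>

lemma switch_lamp:
  assumes "finite A" "c \<in> A"
  shows "Pi_pmf A \<one> (\<lambda>x. conv_power D \<nu> (L x + of_bool (x = c))) =
    do {b \<leftarrow> \<nu>; f \<leftarrow> Pi_pmf A \<one> (\<lambda>x. conv_power D \<nu> (L x)); return_pmf (touch c b f)}"
proof -
  define B where "B = A - {c}"
  have A: "A = insert c B" "finite B" "c \<notin> B"
    using assms by (auto simp: B_def)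
  have B: "Pi_pmf B \<one> (\<lambda>x. conv_power D \<nu> (L x + of_bool (x = c))) = Pi_pmf B \<one> (\<lambda>x. conv_power D \<nu> (L x))"
    using A by (intro Pi_pmf_cong) auto
  have c: "conv_power D \<nu> (L c + of_bool (c = c)) =
      do {b \<leftarrow> \<nu>; y \<leftarrow> conv_power D \<nu> (L c); return_pmf (b \<otimes> y)}"
    using conv_power_Suc_left[OF is_group support(1), of "L c"] by simp
  show ?thesis
    unfolding A(1) Pi_pmf_insert'[OF A(2,3)] B c
    by (simp add: bind_assoc_pmf bind_return_pmf touch_def)
qed

lemma set_Pi_conv_power:
  assumes "finite A" "f \<in> set_pmf (Pi_pmf A \<one> (\<lambda>x. conv_power D \<nu> (L x)))"
  shows "f x \<in> carrier D"
  using assms set_conv_power[OF is_group support(1)] by (auto simp: set_Pi_pmf PiE_dflt_def) (metis one_closed subset_iff)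

text \<open>
  Given the trajectory, the lamps are independent, and the one at \<open>x\<close> has performed \<open>visits ss x\<close> steps of the
  walk on the lamp group. The index set \<open>A\<close> only has to contain all sites that can be reached, as unvisited lamps are
  distributed by the Dirac measure at \<open>\<one>\<close>.
\<close>

lemma conv_power_mu:
  assumes "finite A" "\<And>ss. ss \<in> set_pmf (traj n) \<Longrightarrow> set (positions ss) \<subseteq> A"
  shows "conv_power W \<mu> n =
    do {ss \<leftarrow> traj n; map_pmf (Pair (sum_list ss)) (Pi_pmf A \<one> (\<lambda>x. conv_power D \<nu> (visits ss x)))}"
  using assms(2)
proof (induction n)
  case 0
  then show ?case
    using assms(1) by (simp add: bind_return_pmf W_one)
next
  case (Suc n)
  let ?P = "\<lambda>ss. Pi_pmf A \<one> (\<lambda>x. conv_power D \<nu> (visits ss x))"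
  have A: "insert (s + sum_list ss) (set (positions ss)) \<subseteq> A"
    if "s \<in> set_pmf planar_step" "ss \<in> set_pmf (traj n)" for s ss
    using Suc.prems[of "s # ss"] that by auto
  have IH: "conv_power W \<mu> n = do {ss \<leftarrow> traj n; map_pmf (Pair (sum_list ss)) (?P ss)}"
    using A set_pmf_not_empty[of planar_step] by (intro Suc.IH) blast
  have "conv_power W \<mu> (Suc n) = do {s \<leftarrow> planar_step; (a, b) \<leftarrow> pair_pmf \<nu> \<nu>; ss \<leftarrow> traj n; f \<leftarrow> ?P ss;
      return_pmf (switch_step (s, a, b) \<otimes>\<^bsub>W\<^esub> (sum_list ss, f))}"
    unfolding conv_power_Suc_left[OF W_group mu_carrier] IH
    by (simp add: \<mu>_def map_pmf_def pair_pmf_def bind_assoc_pmf bind_return_pmf)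
  also have "\<dots> = do {s \<leftarrow> planar_step; ss \<leftarrow> traj n; (a, b) \<leftarrow> pair_pmf \<nu> \<nu>; f \<leftarrow> ?P ss;
      return_pmf (switch_step (s, a, b) \<otimes>\<^bsub>W\<^esub> (sum_list ss, f))}"
    unfolding case_prod_beta by (rule bind_pmf_cong[OF refl bind_commute_pmf])
  also have "\<dots> = do {s \<leftarrow> planar_step; ss \<leftarrow> traj n; map_pmf (Pair (s + sum_list ss)) (?P (s # ss))}"
  proof (intro bind_pmf_cong refl)
    fix s ss assume s: "s \<in> set_pmf planar_step" and ss: "ss \<in> set_pmf (traj n)"
    let ?c = "sum_list ss"
    have "?P (s # ss) = do {a \<leftarrow> \<nu>; h \<leftarrow> Pi_pmf A \<one> (\<lambda>x. conv_power D \<nu> (visits ss x + of_bool (x = ?c)));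
        return_pmf (touch (s + ?c) a h)}"
      using A[OF s ss] switch_lamp[OF assms(1), of "s + ?c" "\<lambda>x. visits ss x + of_bool (x = ?c)"] by simp
    also have "Pi_pmf A \<one> (\<lambda>x. conv_power D \<nu> (visits ss x + of_bool (x = ?c))) =
        do {b \<leftarrow> \<nu>; f \<leftarrow> ?P ss; return_pmf (touch ?c b f)}"
      using A[OF s ss] sum_list_in_positions[of ss] by (intro switch_lamp assms(1)) auto
    finally have "map_pmf (Pair (s + ?c)) (?P (s # ss)) = do {a \<leftarrow> \<nu>; b \<leftarrow> \<nu>; f \<leftarrow> ?P ss;
        return_pmf (s + ?c, touch (s + ?c) a (touch ?c b f))}"
      by (simp add: map_pmf_def bind_assoc_pmf bind_return_pmf)
    also have "\<dots> = do {a \<leftarrow> \<nu>; b \<leftarrow> \<nu>; f \<leftarrow> ?P ss; return_pmf (switch_step (s, a, b) \<otimes>\<^bsub>W\<^esub> (?c, f))}"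
      using support(1) set_Pi_conv_power[OF assms(1)]
      by (intro bind_pmf_cong refl arg_cong[of _ _ return_pmf] switch_step_mult[symmetric]) auto
    finally show "do {(a, b) \<leftarrow> pair_pmf \<nu> \<nu>; f \<leftarrow> ?P ss; return_pmf (switch_step (s, a, b) \<otimes>\<^bsub>W\<^esub> (?c, f))} =
        map_pmf (Pair (s + ?c)) (?P (s # ss))"
      by (simp add: pair_pmf_def bind_assoc_pmf bind_return_pmf)
  qed
  also have "\<dots> = do {ss \<leftarrow> traj (Suc n); map_pmf (Pair (sum_list ss)) (?P ss)}"
    by (simp add: bind_assoc_pmf bind_return_pmf)
  finally show ?case .
qed

definition sites :: "nat \<Rightarrow> (int \<times> int) set" where
  "sites n = (\<Union>ss\<in>set_pmf (traj n). set (positions ss))"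

lemma sites: "finite (sites n)" "ss \<in> set_pmf (traj n) \<Longrightarrow> set (positions ss) \<subseteq> sites n"
  by (auto simp: sites_def finite_traj)

lemma finite_lamps: "finite (set_pmf (Pi_pmf (sites n) \<one> (\<lambda>x. conv_power D \<nu> (L x))))"
  by (intro finite_set_Pi_pmf finite_conv_power support(2) sites(1))

lemma walk_entropy_nu: "walk_entropy D \<nu> m = cross_entropy (conv_power D \<nu> m) (conv_power D \<nu> m)"
  by (intro walk_entropy_eq_cross_entropy finite_conv_power set_conv_power is_group support)

lemma walk_entropy_mu: "walk_entropy W \<mu> m = cross_entropy (conv_power W \<mu> m) (conv_power W \<mu> m)"
  by (intro walk_entropy_eq_cross_entropy finite_conv_power set_conv_power W_group finite_mu mu_carrier)

section \<open>The lower bound\<close>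

lemma entropy_mu_ge:
  "measure_pmf.expectation (traj n) (\<lambda>ss. \<Sum>x\<in>sites n. walk_entropy D \<nu> (visits ss x)) \<le> walk_entropy W \<mu> n"
proof -
  let ?K = "\<lambda>ss. map_pmf (Pair (sum_list ss)) (Pi_pmf (sites n) \<one> (\<lambda>x. conv_power D \<nu> (visits ss x)))"
  have inj: "inj (Pair c)" for c :: "int \<times> int"
    by (simp add: inj_on_def)
  have "(\<lambda>ss. \<Sum>x\<in>sites n. walk_entropy D \<nu> (visits ss x)) = (\<lambda>ss. cross_entropy (?K ss) (?K ss))"
    by (simp add: cross_entropy_map_inj[OF inj] entropy_Pi_pmf sites(1) finite_conv_power support(2) walk_entropy_nu)
  moreover have "conv_power W \<mu> n = bind_pmf (traj n) ?K"
    by (rule conv_power_mu[OF sites])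
  ultimately show ?thesis
    unfolding walk_entropy_mu using entropy_bind_ge[of "traj n" ?K] finite_lamps by (simp add: finite_traj)
qed

text \<open>
  The switches at all sites add up to \<open>2 n\<close>, and the expected sum of their squares is at most \<open>12 n slog n\<close>.
  So sites switched more than \<open>12 slog n\<close> times account for at most half of all switches, in expectation. On the
  other sites a switch contributes at least \<open>\<kappa> / iter_slog i (12 slog n)\<close> to the entropy.
\<close>

lemma entropy_mu_lower:
  assumes \<kappa>: "\<kappa> \<ge> 0" "\<And>m. m \<ge> 1 \<Longrightarrow> \<kappa> * (m / iter_slog i m) \<le> walk_entropy D \<nu> m" and n: "n \<ge> 1"
  shows "\<kappa> / 12 * (n / iter_slog (Suc i) n) \<le> walk_entropy W \<mu> n"
proof -
  define M where "M = 12 * slog n"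
  have slog: "1 \<le> slog n"
    using n by (intro slog_ge_1) auto
  then have M: "1 \<le> M" by (simp add: M_def)
  define \<gamma> where "\<gamma> = \<kappa> / iter_slog i M"
  have \<gamma>: "0 \<le> \<gamma>"
    using \<kappa>(1) iter_slog_ge_1[OF M, of i] by (simp add: \<gamma>_def)
  \<comment> \<open>The subtracted square truncates smoothly at \<open>M\<close>: beyond \<open>M\<close> the left side is nonpositive, and up to \<open>M\<close>
    the denominator \<open>iter_slog i m\<close> is at most \<open>iter_slog i M\<close>.\<close>
  have site: "\<gamma> * (real m - (real m)\<^sup>2 / M) \<le> walk_entropy D \<nu> m" for m :: nat
  proof (cases "m \<ge> 1 \<and> real m \<le> M")
    case True
    have "\<gamma> * (real m - (real m)\<^sup>2 / M) \<le> \<gamma> * real m"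
      using \<gamma> M by (intro mult_left_mono) auto
    also have "\<dots> \<le> \<kappa> * (m / iter_slog i m)"
      unfolding \<gamma>_def using True \<kappa>(1) iter_slog_mono[of m M i] iter_slog_ge_1[of m i]
      by (auto intro!: divide_left_mono mult_nonneg_nonneg)
    also have "\<dots> \<le> walk_entropy D \<nu> m"
      using True by (intro \<kappa>(2)) auto
    finally show ?thesis .
  next
    case False
    then have "real m * M \<le> real m * real m"
      by (cases "m = 0") (auto intro: mult_left_mono)
    then have "real m - (real m)\<^sup>2 / M \<le> 0"
      using M by (simp add: field_simps power2_eq_square)
    then have "\<gamma> * (real m - (real m)\<^sup>2 / M) \<le> 0"
      using \<gamma> by (rule mult_nonneg_nonpos[rotated])
    also have "0 \<le> walk_entropy D \<nu> m"
      unfolding walk_entropy_nu by (rule cross_entropy_self_nonneg)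
    finally show ?thesis .
  qed
  have "\<gamma> * (2 * n - 12 * n * slog n / M) \<le>
      \<gamma> * (2 * n - measure_pmf.expectation (traj n) (\<lambda>ss. \<Sum>x\<in>sites n. (real (visits ss x))\<^sup>2) / M)"
    using expected_sum_visits_squared_le[OF n sites] \<gamma> M
    by (intro mult_left_mono diff_left_mono divide_right_mono) auto
  also have "\<dots> = measure_pmf.expectation (traj n) (\<lambda>ss. \<gamma> * (2 * n - (\<Sum>x\<in>sites n. (real (visits ss x))\<^sup>2) / M))"
    by (simp add: integrable_measure_pmf_finite finite_traj)
  also have "\<dots> \<le> measure_pmf.expectation (traj n) (\<lambda>ss. \<Sum>x\<in>sites n. walk_entropy D \<nu> (visits ss x))"
  proof (rule expectation_mono_finite[OF finite_traj])
    fix ss assume ss: "ss \<in> set_pmf (traj n)"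
    have "real (2 * n) = (\<Sum>x\<in>sites n. real (visits ss x))"
      using sum_visits[OF sites(1) sites(2)[OF ss]] length_traj[OF ss] by (metis of_nat_sum)
    then have "\<gamma> * (2 * n - (\<Sum>x\<in>sites n. (real (visits ss x))\<^sup>2) / M) =
        (\<Sum>x\<in>sites n. \<gamma> * (real (visits ss x) - (real (visits ss x))\<^sup>2 / M))"
      by (simp add: sum_distrib_left sum_subtractf sum_divide_distrib right_diff_distrib)
    also have "\<dots> \<le> (\<Sum>x\<in>sites n. walk_entropy D \<nu> (visits ss x))"
      by (intro sum_mono site)
    finally show "\<gamma> * (2 * n - (\<Sum>x\<in>sites n. (real (visits ss x))\<^sup>2) / M) \<le>
        (\<Sum>x\<in>sites n. walk_entropy D \<nu> (visits ss x))" .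
  qed
  also have "\<dots> \<le> walk_entropy W \<mu> n"
    by (rule entropy_mu_ge)
  finally have "\<gamma> * n \<le> walk_entropy W \<mu> n"
    using slog by (simp add: M_def)
  moreover have "\<kappa> / (12 * iter_slog i (slog n)) \<le> \<gamma>"
    unfolding \<gamma>_def M_def using \<kappa>(1) iter_slog_ge_1[OF M, of i] slog
    by (intro divide_left_mono iter_slog_mult_le mult_pos_pos) (auto simp: M_def intro: order_less_le_trans[OF zero_less_one] iter_slog_ge_1)
  then have "\<kappa> / (12 * iter_slog i (slog n)) * n \<le> \<gamma> * n"
    by (rule mult_right_mono) simp
  ultimately show ?thesis
    by (simp add: iter_slog_Suc del: funpow.simps)
qed

end

section \<open>The upper bound\<close>

lemma pmf_traj_ge:
  assumes "set us \<subseteq> set_pmf planar_step"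
  shows "(1 / 16) ^ length us \<le> pmf (traj (length us)) us"
  using assms
proof (induction us)
  case (Cons s us)
  have "1 / 16 * (1 / 16) ^ length us \<le> pmf planar_step s * pmf (traj (length us)) us"
    using Cons pmf_planar_step_ge[of s] by (intro mult_mono) auto
  then have "(1 / 16) ^ length (s # us) \<le> pmf planar_step s * (pmf (traj (length us)) us * 1)"
    by simp
  also have "\<dots> \<le> pmf planar_step s * pmf (do {xs \<leftarrow> traj (length us); return_pmf (s # xs)}) (s # us)"
    using pmf_bind_ge[of "traj (length us)" us "\<lambda>xs. return_pmf (s # xs)" "s # us"]
    by (intro mult_left_mono) auto
  also have "\<dots> \<le> pmf (traj (length (s # us))) (s # us)"
    using pmf_bind_ge[of planar_step s "\<lambda>s. do {xs \<leftarrow> traj (length us); return_pmf (s # xs)}" "s # us"]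
    by simp
  finally show ?case .
qed simp

context lamplighter
begin

text \<open>
  A random element of the wreath product that is drawn without reference to \<open>n\<close>: a tour of random length,
  an end point on it, and independent lamps along it. It assigns to an element reached by the walk a probability that
  is only exponentially small in the number of visited sites, apart from the probabilities of the lamps.
\<close>

definition reference :: "'d pmf \<Rightarrow> ((int \<times> int) \<times> (int \<times> int \<Rightarrow> 'd)) pmf" where
  "reference q = do {
    m \<leftarrow> geometric_pmf (1 / 2);
    us \<leftarrow> traj m;
    c \<leftarrow> pmf_of_set (set (positions us));
    map_pmf (Pair c) (Pi_pmf (set (positions us)) \<one> (\<lambda>_. q))}"

text \<open>
  The tour in question covers exactly the visited sites and has fewer than twice as many steps; every step costs
  a bounded factor.
\<close>

lemma pmf_reference_ge:
  assumes ss: "set ss \<subseteq> set_pmf planar_step" and c: "c \<in> set (positions ss)"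
    and f: "\<And>x. x \<notin> set (positions ss) \<Longrightarrow> f x = \<one>"
  shows "exp (- (11 * real (card (set (positions ss))))) * (\<Prod>x\<in>set (positions ss). pmf q (f x)) \<le>
    pmf (reference q) (c, f)"
proof -
  let ?V = "set (positions ss)"
  define k where "k us = do {c \<leftarrow> pmf_of_set (set (positions us));
    map_pmf (Pair c) (Pi_pmf (set (positions us)) \<one> (\<lambda>_. q))}" for us
  define r where "r = card ?V"
  define \<pi> where "\<pi> = (\<Prod>x\<in>?V. pmf q (f x))"
  have \<pi>: "0 \<le> \<pi>" by (simp add: \<pi>_def prod_nonneg)
  obtain us where us: "set us \<subseteq> set_pmf planar_step" "set (positions us) = ?V" "length us + 2 \<le> 2 * r"
    using covering_tour[OF ss] by (auto simp: r_def)
  let ?m = "length us"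
  have r: "0 < r"
    using c by (auto simp: r_def card_gt_0_iff)
  have "real r \<le> exp (real r)"
    using exp_ge_add_one_self[of "real r"] by linarith
  then have e: "exp (- 1) \<le> (1 / 2 :: real)" "exp (- real r) \<le> 1 / real r"
    using exp_ge_add_one_self[of 1] r by (simp_all add: exp_minus inverse_eq_divide frac_le)
  have e4: "exp (- 4) \<le> (1 / 16 :: real)"
    using power_mono[OF e(1), of 4] by (simp add: exp_of_nat_mult[symmetric] power_divide)
  \<comment> \<open>The costs of the length of the tour, of its steps and of the end point, in this order, are merged into one
    exponential in \<open>r\<close>.\<close>
  have "exp (- (11 * real r)) \<le> exp (real ?m * - 1) * exp (- 1) * (exp (real ?m * - 4) * exp (- real r))"
    using us(3) by (simp add: exp_add[symmetric])
  also have "\<dots> = exp (- 1) ^ ?m * exp (- 1) * (exp (- 4) ^ ?m * exp (- real r))"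
    by (simp only: exp_of_nat_mult)
  also have "\<dots> \<le> (1 / 2) ^ ?m * (1 / 2) * ((1 / 16) ^ ?m * (1 / real r))"
    by (intro mult_mono power_mono e e4) auto
  finally have "exp (- (11 * real r)) * \<pi> \<le> (1 / 2) ^ ?m * (1 / 2) * ((1 / 16) ^ ?m * (1 / real r)) * \<pi>"
    using \<pi> by (rule mult_right_mono)
  also have "\<dots> = (1 / 2) ^ ?m * (1 / 2) * ((1 / 16) ^ ?m * (1 / real r * \<pi>))"
    by simp
  also have "\<dots> \<le> pmf (geometric_pmf (1 / 2)) ?m * (pmf (traj ?m) us * (pmf (pmf_of_set ?V) c * \<pi>))"
  proof -
    have "pmf (pmf_of_set ?V) c = 1 / real r"
      using c by (subst pmf_of_set) (auto simp: r_def)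
    then show ?thesis
      using us(1) \<pi> by (intro mult_mono pmf_traj_ge) auto
  qed
  finally have le: "exp (- (11 * real r)) * \<pi> \<le>
      pmf (geometric_pmf (1 / 2)) ?m * (pmf (traj ?m) us * (pmf (pmf_of_set ?V) c * \<pi>))" .
  have \<pi>_eq: "\<pi> = pmf (map_pmf (Pair c) (Pi_pmf ?V \<one> (\<lambda>_. q))) (c, f)"
    using f by (simp add: \<pi>_def pmf_map_inj' inj_on_def pmf_Pi')
  note le
  also have "pmf (geometric_pmf (1 / 2)) ?m * (pmf (traj ?m) us * (pmf (pmf_of_set ?V) c * \<pi>)) \<le>
      pmf (geometric_pmf (1 / 2)) ?m * (pmf (traj ?m) us * pmf (k us) (c, f))"
    using pmf_bind_ge[of "pmf_of_set ?V" c "\<lambda>c. map_pmf (Pair c) (Pi_pmf ?V \<one> (\<lambda>_. q))" "(c, f)"]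
    unfolding \<pi>_eq by (intro mult_left_mono) (simp_all only: k_def us(2) pmf_nonneg)
  also have "\<dots> \<le> pmf (geometric_pmf (1 / 2)) ?m * pmf (bind_pmf (traj ?m) k) (c, f)"
    by (intro mult_left_mono pmf_bind_ge pmf_nonneg)
  also have "\<dots> \<le> pmf (bind_pmf (geometric_pmf (1 / 2)) (\<lambda>m. bind_pmf (traj m) k)) (c, f)"
    by (rule pmf_bind_ge)
  also have "bind_pmf (geometric_pmf (1 / 2)) (\<lambda>m. bind_pmf (traj m) k) = reference q"
    unfolding reference_def k_def ..
  finally show ?thesis
    by (simp add: \<pi>_def r_def)
qed

text \<open>
  The cost of an element is linear in the range plus the cost of its lamps. With \<open>T = slog n\<close>, a lamp switched
  \<open>m\<close> times costs at most \<open>K (T + m) / iter_slog i T\<close>: for \<open>m \<le> T\<close> by monotonicity of \<open>x / iter_slog i x\<close>, and for larger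
  \<open>m\<close> because the denominator grows. As the range is of order \<open>n / T\<close> and the number of switches is \<open>2 n\<close>, the terms
  add up to order \<open>n / iter_slog i T\<close>.
\<close>

lemma cross_entropy_reference:
  assumes q: "\<And>m. m \<ge> 1 \<Longrightarrow> set_pmf (conv_power D \<nu> m) \<subseteq> set_pmf q"
    and K: "K \<ge> 0" "\<And>m. m \<ge> 1 \<Longrightarrow> cross_entropy (conv_power D \<nu> m) q \<le> K * (m / iter_slog i m)"
    and n: "n \<ge> 1"
  shows "set_pmf (conv_power W \<mu> n) \<subseteq> set_pmf (reference q)"
    and "cross_entropy (conv_power W \<mu> n) (reference q) \<le> (264 + 26 * K) * (n / iter_slog (Suc i) n)"
proof -
  let ?V = "\<lambda>ss. set (positions ss)"
  let ?P = "\<lambda>ss. Pi_pmf (sites n) \<one> (\<lambda>x. conv_power D \<nu> (visits ss x))"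
  let ?K = "\<lambda>ss. map_pmf (Pair (sum_list ss)) (?P ss)"
  have rep: "conv_power W \<mu> n = bind_pmf (traj n) ?K"
    by (rule conv_power_mu[OF sites])
  have visits: "visits ss x \<ge> 1" if "ss \<in> set_pmf (traj n)" "x \<in> ?V ss" for ss x
    using visits_pos[OF that(2)] length_traj[OF that(1)] n by force
  have lamp: "0 < pmf q (f x)" if "ss \<in> set_pmf (traj n)" "f \<in> set_pmf (?P ss)" "x \<in> ?V ss" for ss f x
  proof -
    have "f x \<in> set_pmf (map_pmf (\<lambda>f. f x) (?P ss))"
      using that(2) by simp
    also have "map_pmf (\<lambda>f. f x) (?P ss) = conv_power D \<nu> (visits ss x)"
      using sites(2)[OF that(1)] that(3) by (subst Pi_pmf_component[OF sites(1)]) auto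
    finally have "f x \<in> set_pmf (conv_power D \<nu> (visits ss x))" .
    then show ?thesis
      using q[OF visits[OF that(1,3)]] by (auto simp: pmf_positive)
  qed
  have pmf_ge: "exp (- (11 * real (card (?V ss)))) * (\<Prod>x\<in>?V ss. pmf q (f x)) \<le> pmf (reference q) (sum_list ss, f)"
    if "ss \<in> set_pmf (traj n)" "f \<in> set_pmf (?P ss)" for ss f
  proof (rule pmf_reference_ge)
    show "set ss \<subseteq> set_pmf planar_step"
      using that(1) by (auto simp: set_replicate_pmf)
    show "f x = \<one>" if "x \<notin> ?V ss" for x
    proof -
      have "f x \<in> set_pmf (map_pmf (\<lambda>f. f x) (?P ss))"
        using \<open>f \<in> set_pmf (?P ss)\<close> by simp
      then show ?thesis
        by (simp add: Pi_pmf_component[OF sites(1)] visits_eq_0[OF that] del: set_map_pmf split: if_splits)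
    qed
  qed (rule sum_list_in_positions)
  have prod_pos: "0 < (\<Prod>x\<in>?V ss. pmf q (f x))"
    if "ss \<in> set_pmf (traj n)" "f \<in> set_pmf (?P ss)" for ss f
    using lamp[OF that] by (intro prod_pos) auto
  show "set_pmf (conv_power W \<mu> n) \<subseteq> set_pmf (reference q)"
  proof
    fix g assume "g \<in> set_pmf (conv_power W \<mu> n)"
    then obtain ss f where g: "ss \<in> set_pmf (traj n)" "f \<in> set_pmf (?P ss)" "g = (sum_list ss, f)"
      unfolding rep by auto
    have "0 < exp (- (11 * real (card (?V ss)))) * (\<Prod>x\<in>?V ss. pmf q (f x))"
      using prod_pos[OF g(1,2)] by simp
    also have "\<dots> \<le> pmf (reference q) g"
      using pmf_ge[OF g(1,2)] g(3) by simp
    finally show "g \<in> set_pmf (reference q)"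
      by (simp add: set_pmf_iff)
  qed
  define T where "T = slog n"
  have T: "1 \<le> T"
    unfolding T_def using n by (intro slog_ge_1) auto
  have cost: "cross_entropy (conv_power D \<nu> m) q \<le> K / iter_slog i T * (T + m)" if "m \<ge> 1" for m
  proof -
    have "m / iter_slog i m \<le> (T + m) / iter_slog i T"
    proof (cases "real m \<le> T")
      case True
      then have "m / iter_slog i m \<le> T / iter_slog i T"
        using that by (intro div_iter_slog_mono) auto
      also have "\<dots> \<le> (T + m) / iter_slog i T"
        using iter_slog_ge_1[OF T, of i] by (intro divide_right_mono) auto
      finally show ?thesis .
    next
      case False
      then have "m / iter_slog i m \<le> m / iter_slog i T"
        using T iter_slog_mono[of T m i] iter_slog_ge_1[OF T, of i] iter_slog_ge_1[of m i] that
        by (intro divide_left_mono) auto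
      also have "\<dots> \<le> (T + m) / iter_slog i T"
        using iter_slog_ge_1[OF T, of i] T by (intro divide_right_mono) auto
      finally show ?thesis .
    qed
    then have "K * (m / iter_slog i m) \<le> K * ((T + m) / iter_slog i T)"
      using K(1) by (rule mult_left_mono)
    then show ?thesis
      using K(2)[OF that] by simp
  qed
  define a where "a = K / iter_slog i T"
  have a: "0 \<le> a"
    using K(1) iter_slog_ge_1[OF T, of i] by (simp add: a_def)
  have traj_cost: "measure_pmf.expectation (?K ss) (\<lambda>g. - ln (pmf (reference q) g)) \<le>
      (11 + a * T) * card (?V ss) + a * (2 * n)" if ss: "ss \<in> set_pmf (traj n)" for ss
  proof -
    have "measure_pmf.expectation (?K ss) (\<lambda>g. - ln (pmf (reference q) g)) =
        measure_pmf.expectation (?P ss) (\<lambda>f. - ln (pmf (reference q) (sum_list ss, f)))"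
      by simp
    also have "\<dots> \<le> measure_pmf.expectation (?P ss) (\<lambda>f. 11 * card (?V ss) + (\<Sum>x\<in>?V ss. - ln (pmf q (f x))))"
    proof (rule expectation_mono_finite[OF finite_lamps])
      fix f assume f: "f \<in> set_pmf (?P ss)"
      have "ln (exp (- (11 * real (card (?V ss)))) * (\<Prod>x\<in>?V ss. pmf q (f x))) \<le> ln (pmf (reference q) (sum_list ss, f))"
        using prod_pos[OF ss f] by (intro ln_mono pmf_ge[OF ss f]) auto
      moreover have "ln (exp (- (11 * real (card (?V ss)))) * (\<Prod>x\<in>?V ss. pmf q (f x))) =
          - (11 * real (card (?V ss))) + ln (\<Prod>x\<in>?V ss. pmf q (f x))"
        using ln_mult_pos[OF exp_gt_zero prod_pos[OF ss f]] by (simp only: ln_exp)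
      moreover have "ln (\<Prod>x\<in>?V ss. pmf q (f x)) = (\<Sum>x\<in>?V ss. ln (pmf q (f x)))"
        using lamp[OF ss f] by (intro ln_prod) force+
      ultimately show "- ln (pmf (reference q) (sum_list ss, f)) \<le> 11 * card (?V ss) + (\<Sum>x\<in>?V ss. - ln (pmf q (f x)))"
        by (simp add: sum_negf)
    qed
    also have "\<dots> = measure_pmf.expectation (?P ss) (\<lambda>f. 11 * card (?V ss)) +
        measure_pmf.expectation (?P ss) (\<lambda>f. \<Sum>x\<in>?V ss. - ln (pmf q (f x)))"
      by (intro Bochner_Integration.integral_add integrable_measure_pmf_finite finite_lamps)
    also have "measure_pmf.expectation (?P ss) (\<lambda>f. 11 * card (?V ss)) = 11 * card (?V ss)"
      by simp
    also have "measure_pmf.expectation (?P ss) (\<lambda>f. \<Sum>x\<in>?V ss. - ln (pmf q (f x))) =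
        (\<Sum>x\<in>?V ss. cross_entropy (conv_power D \<nu> (visits ss x)) q)"
      unfolding cross_entropy_def
      using expectation_Pi_pmf_sum[OF sites(1) finite_conv_power[OF support(2)] sites(2)[OF ss], where h = "\<lambda>_ y. - ln (pmf q y)"]
      by simp
    also have "\<dots> \<le> (\<Sum>x\<in>?V ss. a * (T + visits ss x))"
      unfolding a_def by (intro sum_mono cost visits ss)
    also have "\<dots> = a * (T * card (?V ss) + (\<Sum>x\<in>?V ss. visits ss x))"
      by (simp add: sum_distrib_left[symmetric] sum.distrib)
    also have "(\<Sum>x\<in>?V ss. visits ss x) = 2 * n"
      using sum_visits[of "?V ss" ss] length_traj[OF ss] by simp
    finally show ?thesis
      by (simp add: algebra_simps)
  qed
  have "cross_entropy (conv_power W \<mu> n) (reference q) =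
      measure_pmf.expectation (traj n) (\<lambda>ss. measure_pmf.expectation (?K ss) (\<lambda>g. - ln (pmf (reference q) g)))"
    unfolding cross_entropy_def rep using finite_lamps
    by (intro expectation_bind_finite finite_traj) simp
  also have "\<dots> \<le> measure_pmf.expectation (traj n) (\<lambda>ss. (11 + a * T) * card (?V ss) + a * (2 * n))"
    by (intro expectation_mono_finite finite_traj traj_cost)
  also have "\<dots> = (11 + a * T) * measure_pmf.expectation (traj n) (\<lambda>ss. real (card (?V ss))) + a * (2 * n)"
    by (simp add: integrable_measure_pmf_finite finite_traj)
  also have "\<dots> \<le> (11 + a * T) * (24 * n / T) + a * (2 * n)"
    unfolding T_def using expected_range_le[OF n] a T
    by (intro add_right_mono mult_left_mono) (auto simp: T_def)
  also have "\<dots> = 264 * (n / T) + 26 * (a * n)"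
    using T by (simp add: field_simps)
  also have "\<dots> \<le> 264 * (n / iter_slog i T) + 26 * (a * n)"
    using iter_slog_le[OF T, of i] iter_slog_ge_1[OF T, of i] T
    by (intro add_right_mono mult_left_mono divide_left_mono) auto
  also have "\<dots> = (264 + 26 * K) * (n / iter_slog (Suc i) n)"
    unfolding a_def iter_slog_Suc T_def[symmetric] by (simp add: add_divide_distrib algebra_simps)
  finally show "cross_entropy (conv_power W \<mu> n) (reference q) \<le> (264 + 26 * K) * (n / iter_slog (Suc i) n)" .
qed

end

section \<open>Iterating the construction\<close>

text \<open>
  The statement carried through the induction. The upper bound is one for a cross-entropy relative to a
  single \<open>q\<close> serving all times \<open>n\<close>, since the number of steps made by a lamp is random. The identity is required in the
  support so that the lamplighter can move without switching.
\<close>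

definition walk_of_rate :: "nat \<Rightarrow> ('a, 'm) monoid_scheme \<Rightarrow> 'a pmf \<Rightarrow> bool" where
  "walk_of_rate i G \<mu> \<longleftrightarrow>
    random_walk_measure G \<mu> \<and> \<one>\<^bsub>G\<^esub> \<in> set_pmf \<mu> \<and>
    (\<exists>\<kappa>>0. \<forall>n\<ge>1. \<kappa> * (n / iter_slog i n) \<le> walk_entropy G \<mu> n) \<and>
    (\<exists>q. \<exists>K\<ge>0. \<forall>n\<ge>1. set_pmf (conv_power G \<mu> n) \<subseteq> set_pmf q \<and>
      cross_entropy (conv_power G \<mu> n) q \<le> K * (n / iter_slog i n))"

lemma walk_of_rate_wreath:
  assumes "group D" "walk_of_rate i D \<nu>"
  shows "\<exists>\<mu>. walk_of_rate (Suc i) (wreath Z2 D) \<mu>"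
proof -
  interpret lamplighter D \<nu>
    using assms by (simp add: lamplighter_def lamplighter_axioms_def walk_of_rate_def)
  obtain \<kappa> where \<kappa>: "\<kappa> > 0" "\<And>m. m \<ge> 1 \<Longrightarrow> \<kappa> * (m / iter_slog i m) \<le> walk_entropy D \<nu> m"
    using assms(2) unfolding walk_of_rate_def by blast
  obtain q K where K: "K \<ge> 0" "\<And>m. m \<ge> 1 \<Longrightarrow> set_pmf (conv_power D \<nu> m) \<subseteq> set_pmf q"
      "\<And>m. m \<ge> 1 \<Longrightarrow> cross_entropy (conv_power D \<nu> m) q \<le> K * (m / iter_slog i m)"
    using assms(2) unfolding walk_of_rate_def by blast
  have "\<exists>\<kappa>'>0. \<forall>n\<ge>1. \<kappa>' * (n / iter_slog (Suc i) n) \<le> walk_entropy W \<mu> n"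
    using entropy_mu_lower[OF less_imp_le[OF \<kappa>(1)] \<kappa>(2)] \<kappa>(1) by (intro exI[of _ "\<kappa> / 12"]) auto
  moreover have "\<exists>q. \<exists>K'\<ge>0. \<forall>n\<ge>1. set_pmf (conv_power W \<mu> n) \<subseteq> set_pmf q \<and>
      cross_entropy (conv_power W \<mu> n) q \<le> K' * (n / iter_slog (Suc i) n)"
    using cross_entropy_reference[OF K(2,1,3)] K(1)
    by (intro exI[of _ "reference q"] exI[of _ "264 + 26 * K"]) simp
  ultimately show ?thesis
    unfolding walk_of_rate_def using random_walk_mu one_in_mu by blast
qed

lemma conv_power_iso:
  assumes "group G" "group H" "h \<in> iso G H" "set_pmf \<mu> \<subseteq> carrier G"
  shows "conv_power H (map_pmf h \<mu>) n = map_pmf h (conv_power G \<mu> n)"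
proof -
  interpret group_hom G H h
    using assms by (simp add: group_hom_def group_hom_axioms_def iso_def)
  show ?thesis
  proof (induction n)
    case (Suc n)
    have "conv_power H (map_pmf h \<mu>) (Suc n) =
        map_pmf (\<lambda>(x, y). h x \<otimes>\<^bsub>H\<^esub> h y) (pair_pmf (conv_power G \<mu> n) \<mu>)"
      unfolding conv_power.simps Suc map_pair[symmetric] pmf.map_comp by (simp add: o_def case_prod_beta')
    also have "\<dots> = map_pmf (\<lambda>(x, y). h (x \<otimes>\<^bsub>G\<^esub> y)) (pair_pmf (conv_power G \<mu> n) \<mu>)"
      using set_conv_power[OF assms(1,4), of n] assms(4) by (intro map_pmf_cong refl) (auto simp: subset_iff)
    also have "\<dots> = map_pmf h (conv_power G \<mu> (Suc n))"
      by (simp add: pmf.map_comp o_def case_prod_beta')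
    finally show ?case .
  qed simp
qed

lemma walk_of_rate_iso:
  assumes G: "group G" and H: "group H" and h: "h \<in> iso G H" "inj h" and walk: "walk_of_rate i G \<mu>"
  shows "walk_of_rate i H (map_pmf h \<mu>)"
proof -
  interpret group_hom G H h
    using assms by (simp add: group_hom_def group_hom_axioms_def iso_def)
  have \<mu>: "set_pmf \<mu> \<subseteq> carrier G" "finite (set_pmf \<mu>)" "generate G (set_pmf \<mu>) = carrier G"
      "\<And>g. g \<in> carrier G \<Longrightarrow> pmf \<mu> (inv\<^bsub>G\<^esub> g) = pmf \<mu> g" "\<one>\<^bsub>G\<^esub> \<in> set_pmf \<mu>"
    using walk by (auto simp: walk_of_rate_def random_walk_measure_def)
  have carrier: "carrier H = h ` carrier G"
    using h(1) by (simp add: iso_def bij_betw_def)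
  have "random_walk_measure H (map_pmf h \<mu>)"
    unfolding random_walk_measure_def
  proof (intro conjI ballI)
    show "pmf (map_pmf h \<mu>) (inv\<^bsub>H\<^esub> g) = pmf (map_pmf h \<mu>) g" if g: "g \<in> carrier H" for g
    proof -
      obtain x where x: "g = h x" "x \<in> carrier G"
        using g unfolding carrier by blast
      then have "inv\<^bsub>H\<^esub> g = h (inv\<^bsub>G\<^esub> x)" by simp
      then have "pmf (map_pmf h \<mu>) (inv\<^bsub>H\<^esub> g) = pmf \<mu> (inv\<^bsub>G\<^esub> x)"
        by (simp only: pmf_map_inj'[OF h(2)])
      then show ?thesis
        using x by (simp add: pmf_map_inj'[OF h(2)] \<mu>(4))
    qed
    show "generate H (set_pmf (map_pmf h \<mu>)) = carrier H"
      using generate_img[OF \<mu>(1)] by (simp add: \<mu>(3) carrier)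
  qed (use \<mu> carrier in auto)
  have one: "\<one>\<^bsub>H\<^esub> \<in> set_pmf (map_pmf h \<mu>)"
    using imageI[OF \<mu>(5), of h] by simp
  have conv: "conv_power H (map_pmf h \<mu>) n = map_pmf h (conv_power G \<mu> n)" for n
    by (rule conv_power_iso[OF G H h(1) \<mu>(1)])
  have entropy: "walk_entropy H (map_pmf h \<mu>) n = walk_entropy G \<mu> n" for n
  proof -
    have "walk_entropy H (map_pmf h \<mu>) n = cross_entropy (map_pmf h (conv_power G \<mu> n)) (map_pmf h (conv_power G \<mu> n))"
      unfolding conv[symmetric] using \<mu>(1,2) carrier
      by (intro walk_entropy_eq_cross_entropy finite_conv_power set_conv_power H) auto
    also have "\<dots> = cross_entropy (conv_power G \<mu> n) (conv_power G \<mu> n)"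
      by (rule cross_entropy_map_inj[OF h(2)])
    also have "\<dots> = walk_entropy G \<mu> n"
      by (intro walk_entropy_eq_cross_entropy[symmetric] finite_conv_power set_conv_power G \<mu>(1,2))
    finally show ?thesis .
  qed
  have "\<exists>q. \<exists>K\<ge>0. \<forall>n\<ge>1. set_pmf (conv_power H (map_pmf h \<mu>) n) \<subseteq> set_pmf q \<and>
      cross_entropy (conv_power H (map_pmf h \<mu>) n) q \<le> K * (n / iter_slog i n)"
  proof -
    obtain q K where q: "K \<ge> 0" "\<forall>n\<ge>1. set_pmf (conv_power G \<mu> n) \<subseteq> set_pmf q \<and>
        cross_entropy (conv_power G \<mu> n) q \<le> K * (n / iter_slog i n)"
      using walk unfolding walk_of_rate_def by blast
    then show ?thesis
      by (intro exI[of _ "map_pmf h q"] exI[of _ K]) (auto simp: conv cross_entropy_map_inj h(2))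
  qed
  moreover have "\<exists>\<kappa>>0. \<forall>n\<ge>1. \<kappa> * (n / iter_slog i n) \<le> walk_entropy H (map_pmf h \<mu>) n"
    using walk unfolding walk_of_rate_def entropy by blast
  ultimately show ?thesis
    using \<open>random_walk_measure H (map_pmf h \<mu>)\<close> one unfolding walk_of_rate_def by blast
qed

text \<open>
  The uniform distribution is stationary from the first step on, so the entropy is the constant \<open>ln (card F)\<close>,
  which is \<open>n / iter_slog 0 n\<close> up to a factor.
\<close>

lemma walk_of_rate_finite:
  assumes "group F" "finite (carrier F)" "\<not> trivial_group F"
  shows "walk_of_rate 0 F (pmf_of_set (carrier F))"
proof -
  interpret group F by fact
  let ?u = "pmf_of_set (carrier F)"
  have ne: "carrier F \<noteq> {}"
    by auto
  have set_u: "set_pmf ?u = carrier F"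
    using ne assms(2) by simp
  have translate: "map_pmf (\<lambda>y. x \<otimes>\<^bsub>F\<^esub> y) ?u = ?u" if "x \<in> carrier F" for x
  proof (rule map_pmf_of_set_bij_betw[OF _ ne assms(2)])
    show "bij_betw (\<lambda>y. x \<otimes>\<^bsub>F\<^esub> y) (carrier F) (carrier F)"
      using that inj_on_cmult surj_const_mult by (simp add: bij_betw_def)
  qed
  have conv: "conv_power F ?u (Suc n) = ?u" for n
  proof -
    have "conv_power F ?u (Suc n) = do {x \<leftarrow> conv_power F ?u n; map_pmf (\<lambda>y. x \<otimes>\<^bsub>F\<^esub> y) ?u}"
      by (simp add: map_pmf_def pair_pmf_def bind_assoc_pmf bind_return_pmf)
    also have "\<dots> = do {x \<leftarrow> conv_power F ?u n; ?u}"
      using set_conv_power[OF assms(1), of ?u n] set_u by (intro bind_pmf_cong refl translate) auto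
    finally show ?thesis by simp
  qed
  have entropy: "cross_entropy (conv_power F ?u n) ?u = ln (card (carrier F))" if "n \<ge> 1" for n
  proof -
    have "cross_entropy ?u ?u = measure_pmf.expectation ?u (\<lambda>_. ln (card (carrier F)))"
      unfolding cross_entropy_def using ne assms(2)
      by (intro expectation_cong) (simp add: ln_div)
    then show ?thesis
      using conv[of "n - 1"] that by simp
  qed
  have walk: "walk_entropy F ?u n = ln (card (carrier F))" if "n \<ge> 1" for n
  proof -
    have "walk_entropy F ?u n = cross_entropy (conv_power F ?u n) (conv_power F ?u n)"
      using assms(2) set_u
      by (intro walk_entropy_eq_cross_entropy finite_conv_power set_conv_power assms(1)) auto
    then show ?thesis
      using entropy[OF that] conv[of "n - 1"] that by simp
  qed
  have "carrier F \<noteq> {\<one>\<^bsub>F\<^esub>}"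
    using assms(1,3) by (simp add: trivial_group_def)
  then have "card (carrier F) \<noteq> 1"
    by (metis card_1_singletonE one_closed singletonD)
  moreover have "card (carrier F) \<noteq> 0"
    using ne assms(2) by simp
  ultimately have "1 < real (card (carrier F))"
    by linarith
  then have pos: "0 < ln (card (carrier F))"
    by simp
  have "generate F (carrier F) = carrier F"
    using generate_incl[of "carrier F"] generate.incl[of _ "carrier F" F] by blast
  then have "random_walk_measure F ?u"
    using assms(2) ne by (simp add: random_walk_measure_def set_u)
  moreover have "set_pmf (conv_power F ?u n) \<subseteq> set_pmf ?u" for n
    using set_conv_power[OF assms(1), of ?u n] set_u by simp
  ultimately show ?thesis
    unfolding walk_of_rate_def using pos set_u
    by (auto simp: walk entropy intro!: exI[of _ "ln (card (carrier F))"] exI[of _ ?u])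
qed

lemma walk_of_rate_iter_wreath:
  assumes "group F" "finite (carrier F)" "\<not> trivial_group F"
  shows "\<exists>\<mu>. walk_of_rate i (iter_wreath F i) \<mu>"
proof (induction i)
  case 0
  have inj: "inj Base" by (simp add: inj_on_def)
  then have "Base \<in> iso F (iter_wreath F 0)"
    using inj_imp_image_group_iso[of Base F] by (simp add: inj_on_def)
  from walk_of_rate_iso[OF assms(1) group_iter_wreath[OF assms(1)] this inj walk_of_rate_finite[OF assms]]
  show ?case by blast
next
  case (Suc i)
  let ?N = "\<lambda>(c, f). Node c f"
  have G: "group (iter_wreath F i)"
    by (rule group_iter_wreath[OF assms(1)])
  obtain \<mu> where \<mu>: "walk_of_rate (Suc i) (wreath Z2 (iter_wreath F i)) \<mu>"
    using Suc walk_of_rate_wreath[OF G] by blast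
  have inj: "inj ?N" by (auto simp: inj_on_def)
  then have "?N \<in> iso (wreath Z2 (iter_wreath F i)) (iter_wreath F (Suc i))"
    unfolding iter_wreath.simps by (intro inj_imp_image_group_iso) (auto simp: inj_on_def)
  from walk_of_rate_iso[OF group_wreath[OF group_Z2 G] group_iter_wreath[OF assms(1)] this inj \<mu>]
  show ?case by blast
qed

section \<open>Comparison with iterated natural logarithms\<close>

lemma walk_of_rate_upper:
  assumes "group G" "walk_of_rate i G \<mu>"
  shows "\<exists>K>0. \<forall>\<^sub>F n in sequentially. walk_entropy G \<mu> n \<le> K * (real n / (ln ^^ i) (real n))"
proof -
  obtain q K where q: "K \<ge> 0" "\<And>n. n \<ge> 1 \<Longrightarrow> set_pmf (conv_power G \<mu> n) \<subseteq> set_pmf q"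
      "\<And>n. n \<ge> 1 \<Longrightarrow> cross_entropy (conv_power G \<mu> n) q \<le> K * (n / iter_slog i n)"
    using assms(2) unfolding walk_of_rate_def by blast
  have \<mu>: "set_pmf \<mu> \<subseteq> carrier G" "finite (set_pmf \<mu>)"
    using assms(2) by (auto simp: walk_of_rate_def random_walk_measure_def)
  have "\<forall>\<^sub>F x in at_top. 0 < (ln ^^ i) (x :: real)"
    using filterlim_iter_ln[of i] unfolding filterlim_at_top_dense by blast
  with iter_ln_le_iter_slog[of i] have "\<forall>\<^sub>F x in at_top. 0 < (ln ^^ i) (x :: real) \<and> (ln ^^ i) x \<le> iter_slog i x"
    by eventually_elim simp
  then have "\<forall>\<^sub>F n in sequentially. 0 < (ln ^^ i) (real n) \<and> (ln ^^ i) (real n) \<le> iter_slog i (real n)"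
    using filterlim_real_sequentially by (rule eventually_compose_filterlim)
  with eventually_ge_at_top[of 1] have "\<forall>\<^sub>F n in sequentially. walk_entropy G \<mu> n \<le> (K + 1) * (real n / (ln ^^ i) (real n))"
  proof eventually_elim
    case (elim n)
    have "walk_entropy G \<mu> n = cross_entropy (conv_power G \<mu> n) (conv_power G \<mu> n)"
      by (intro walk_entropy_eq_cross_entropy finite_conv_power set_conv_power assms(1) \<mu>)
    also have "\<dots> \<le> cross_entropy (conv_power G \<mu> n) q"
      using elim by (intro entropy_le_cross_entropy finite_conv_power \<mu> q(2)) auto
    also have "\<dots> \<le> K * (real n / iter_slog i n)"
      using elim by (intro q(3)) auto
    also have "\<dots> \<le> (K + 1) * (real n / (ln ^^ i) (real n))"
      using elim q(1) iter_slog_ge_1[of n i] by (intro mult_mono divide_left_mono) auto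
    finally show ?case .
  qed
  then show ?thesis
    using q(1) by (intro exI[of _ "K + 1"]) auto
qed

lemma walk_of_rate_lower:
  assumes "walk_of_rate i G \<mu>"
  shows "\<exists>K>0. \<forall>\<^sub>F n in sequentially. K * (real n / ((ln ^^ i) (real n))\<^sup>2) \<le> walk_entropy G \<mu> n"
proof -
  obtain \<kappa> where \<kappa>: "\<kappa> > 0" "\<And>m. m \<ge> 1 \<Longrightarrow> \<kappa> * (m / iter_slog i m) \<le> walk_entropy G \<mu> m"
    using assms unfolding walk_of_rate_def by blast
  obtain C where C: "C \<ge> 1" "\<forall>\<^sub>F x in at_top. iter_slog i x \<le> C * (ln ^^ i) x"
    using iter_slog_le_iter_ln by blast
  have "\<forall>\<^sub>F x in at_top. 1 \<le> (ln ^^ i) (x :: real)"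
    using filterlim_iter_ln[of i] unfolding filterlim_at_top by blast
  with C(2) have "\<forall>\<^sub>F x in at_top. 1 \<le> (ln ^^ i) (x :: real) \<and> iter_slog i x \<le> C * (ln ^^ i) x"
    by eventually_elim simp
  then have "\<forall>\<^sub>F n in sequentially. 1 \<le> (ln ^^ i) (real n) \<and> iter_slog i (real n) \<le> C * (ln ^^ i) (real n)"
    using filterlim_real_sequentially by (rule eventually_compose_filterlim)
  with eventually_ge_at_top[of 1] have "\<forall>\<^sub>F n in sequentially. \<kappa> / C * (real n / ((ln ^^ i) (real n))\<^sup>2) \<le> walk_entropy G \<mu> n"
  proof eventually_elim
    case (elim n)
    let ?l = "(ln ^^ i) (real n)"
    have "iter_slog i n \<le> C * ?l"
      using elim by blast
    also have "\<dots> \<le> C * ?l\<^sup>2"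
      using elim C(1) self_le_power[of ?l 2] by (intro mult_left_mono) auto
    finally have "iter_slog i n \<le> C * ?l\<^sup>2" .
    then have "real n / (C * ?l\<^sup>2) \<le> n / iter_slog i n"
      using elim C(1) iter_slog_ge_1[of n i] by (intro divide_left_mono mult_pos_pos) auto
    then have "\<kappa> * (real n / (C * ?l\<^sup>2)) \<le> \<kappa> * (n / iter_slog i n)"
      using \<kappa>(1) by (intro mult_left_mono) auto
    also have "\<dots> \<le> walk_entropy G \<mu> n"
      using elim by (intro \<kappa>(2)) auto
    finally show ?case by simp
  qed
  then show ?thesis
    using \<kappa>(1) C(1) by (intro exI[of _ "\<kappa> / C"]) auto
qed

text \<open>
  With \<open>y\<close> the \<open>i\<close>-fold logarithm of \<open>n\<close>, the \<open>j\<close>-fold logarithm is at most \<open>ln y\<close>, whose square is negligible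
  compared to \<open>y\<close>.
\<close>

lemma iter_ln_gap:
  assumes "i < j"
  shows "\<forall>\<^sub>F n in sequentially. C * ((ln ^^ j) (real n))\<^sup>2 < (ln ^^ i) (real n)"
proof -
  define k where "k = j - Suc i"
  have j: "j = k + Suc i" using assms by (simp add: k_def)
  have "\<forall>\<^sub>F x in at_top. (ln ^^ k) x \<le> (x :: real)"
    using iter_ln_le_iter_slog[of k] eventually_ge_at_top[of 1]
  proof eventually_elim
    case (elim x)
    then show ?case
      using iter_slog_le[of x k] by linarith
  qed
  moreover have "\<forall>\<^sub>F x in at_top. 0 \<le> (ln ^^ k) (x :: real)"
    using filterlim_iter_ln[of k] unfolding filterlim_at_top by blast
  ultimately have "\<forall>\<^sub>F x in at_top. 0 \<le> (ln ^^ k) (x :: real) \<and> (ln ^^ k) x \<le> x"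
    by eventually_elim simp
  then have "\<forall>\<^sub>F y in at_top. 0 \<le> (ln ^^ k) (ln y :: real) \<and> (ln ^^ k) (ln y) \<le> ln y"
    using ln_at_top by (rule eventually_compose_filterlim)
  moreover have "\<forall>\<^sub>F y in at_top. B * (ln y)\<^sup>2 < (y :: real)" if "B > 0" for B
    using that by real_asymp
  then have "\<forall>\<^sub>F y in at_top. (\<bar>C\<bar> + 1) * (ln y)\<^sup>2 < (y :: real)"
    by simp
  ultimately have "\<forall>\<^sub>F y in at_top. C * ((ln ^^ k) (ln y))\<^sup>2 < (y :: real)"
  proof eventually_elim
    case (elim y)
    have "C * ((ln ^^ k) (ln y))\<^sup>2 \<le> (\<bar>C\<bar> + 1) * (ln y)\<^sup>2"
      using elim by (intro mult_mono power_mono) auto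
    then show ?case using elim by linarith
  qed
  moreover have "filterlim (\<lambda>n. (ln ^^ i) (real n)) at_top sequentially"
    by (rule filterlim_compose[OF filterlim_iter_ln filterlim_real_sequentially])
  ultimately have "\<forall>\<^sub>F n in sequentially. C * ((ln ^^ k) (ln ((ln ^^ i) (real n))))\<^sup>2 < (ln ^^ i) (real n)"
    by (rule eventually_compose_filterlim)
  then show ?thesis
    by (simp only: j funpow_add funpow.simps o_apply)
qed

lemma not_bigo_of_rates:
  assumes "i < j" "K > 0" "L > 0"
    and lower: "\<forall>\<^sub>F n in sequentially. K * (real n / ((ln ^^ j) (real n))\<^sup>2) \<le> g n"
    and upper: "\<forall>\<^sub>F n in sequentially. f n \<le> L * (real n / (ln ^^ i) (real n))"
    and nonneg: "\<forall>\<^sub>F n in sequentially. 0 \<le> f n"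
  shows "g \<notin> O(f)"
proof
  assume "g \<in> O(f)"
  then obtain c where c: "c > 0" "\<forall>\<^sub>F n in sequentially. norm (g n) \<le> c * norm (f n)"
    by (rule landau_o.bigE)
  have large: "\<forall>\<^sub>F n in sequentially. 0 < (ln ^^ m) (real n)" for m
    using filterlim_compose[OF filterlim_iter_ln filterlim_real_sequentially, of m]
    unfolding filterlim_at_top_dense by blast
  have "\<forall>\<^sub>F n in sequentially. False"
    using c(2) lower upper nonneg large[of i] large[of j] iter_ln_gap[OF assms(1), of "c * L / K"] eventually_gt_at_top[of 0]
  proof eventually_elim
    case (elim n)
    let ?a = "(ln ^^ i) (real n)" and ?b = "(ln ^^ j) (real n)"
    have "K * (real n / ?b\<^sup>2) \<le> c * f n"
      using elim by (simp add: abs_if split: if_splits)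
    also have "\<dots> \<le> c * (L * (real n / ?a))"
      using elim c(1) by (intro mult_left_mono) auto
    finally have "K * ?a \<le> c * L * ?b\<^sup>2"
      using elim by (simp add: field_simps)
    then show ?case
      using elim assms(2) by (simp add: field_simps)
  qed
  then show False by simp
qed

theorem theorem2:
  fixes F :: "('f, 'm) monoid_scheme"
  assumes "group F" and "finite (carrier F)" and "\<not> trivial_group F"
  shows "\<exists>\<mu> :: nat \<Rightarrow> 'f witer pmf.
    (\<forall>i\<ge>1. random_walk_measure (iter_wreath F i) (\<mu> i) \<and>
      (\<exists>K1>0. \<exists>K2>0. \<forall>\<^sub>F n in sequentially.
        K1 * (real n / ((ln ^^ i) (real n))\<^sup>2) \<le> walk_entropy (iter_wreath F i) (\<mu> i) n \<and>
        walk_entropy (iter_wreath F i) (\<mu> i) n \<le> K2 * (real n / (ln ^^ i) (real n)))) \<and>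
    (\<forall>i\<ge>1. \<forall>j\<ge>1. i \<noteq> j \<longrightarrow>
      walk_entropy (iter_wreath F i) (\<mu> i) \<notin> \<Theta>(walk_entropy (iter_wreath F j) (\<mu> j)))"
proof -
  obtain \<mu> where \<mu>: "\<And>i. walk_of_rate i (iter_wreath F i) (\<mu> i)"
    using walk_of_rate_iter_wreath[OF assms] by metis
  let ?H = "\<lambda>i. walk_entropy (iter_wreath F i) (\<mu> i)"
  have upper: "\<exists>K>0. \<forall>\<^sub>F n in sequentially. ?H i n \<le> K * (real n / (ln ^^ i) (real n))" for i
    by (rule walk_of_rate_upper[OF group_iter_wreath[OF assms(1)] \<mu>])
  have lower: "\<exists>K>0. \<forall>\<^sub>F n in sequentially. K * (real n / ((ln ^^ i) (real n))\<^sup>2) \<le> ?H i n" for i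
    by (rule walk_of_rate_lower[OF \<mu>])
  have bounds: "\<exists>K1>0. \<exists>K2>0. \<forall>\<^sub>F n in sequentially.
      K1 * (real n / ((ln ^^ i) (real n))\<^sup>2) \<le> ?H i n \<and> ?H i n \<le> K2 * (real n / (ln ^^ i) (real n))" for i
    using lower[of i] upper[of i] by (auto simp: eventually_conj_iff)
  have not_bigo: "?H j \<notin> O(?H i)" if "i < j" for i j
  proof -
    obtain K L where K: "K > 0" "\<forall>\<^sub>F n in sequentially. K * (real n / ((ln ^^ j) (real n))\<^sup>2) \<le> ?H j n"
      and L: "L > 0" "\<forall>\<^sub>F n in sequentially. ?H i n \<le> L * (real n / (ln ^^ i) (real n))"
      using lower[of j] upper[of i] by blast
    obtain M where M: "M > 0" "\<forall>\<^sub>F n in sequentially. M * (real n / ((ln ^^ i) (real n))\<^sup>2) \<le> ?H i n"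
      using lower[of i] by blast
    from M(2) have "\<forall>\<^sub>F n in sequentially. 0 \<le> ?H i n"
    proof eventually_elim
      case (elim n)
      have "0 \<le> M * (real n / ((ln ^^ i) (real n))\<^sup>2)"
        using M(1) by simp
      then show ?case
        using elim by (rule order_trans)
    qed
    then show ?thesis
      by (rule not_bigo_of_rates[OF that K(1) L(1) K(2) L(2)])
  qed
  have "?H i \<notin> \<Theta>(?H j)" if "i \<noteq> j" for i j
    using not_bigo[of i j] not_bigo[of j i] that bigthetaD1[of "?H i"] bigthetaD2[of "?H i"]
    by (cases i j rule: linorder_cases) (auto simp: bigomega_iff_bigo)
  then show ?thesis
    using \<mu> bounds by (intro exI[of _ \<mu>]) (auto simp: walk_of_rate_def)
qed

end
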